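(* Let $\mathcal T$ and $\mathcal S$ be local approximation classes in $\mathbb{R}^n$ such that $\mathcal T$ points are detectable in $\mathcal S$. If a nonempty set $A\subseteq\mathbb{R}^n$ is locally well approximated by $\mathcal S$, then $A$ can be written as a disjoint union $$A=A_{\overline{\mathcal T}}\cup A_{\mathcal T^\perp},\qquad A_{\overline{\mathcal T}}\cap A_{\mathcal T^\perp}=\emptyset,$$ where $\Psi\text{-}\mathrm{Tan}(\overline A,x)\subseteq\overline{\mathcal S}\cap\overline{\mathcal T}$ for all $x\in A_{\overline{\mathcal T}}$ and $\mathrm{Tan}(\overline A,x)\subseteq\overline{\mathcal S}\cap\mathcal T^\perp$ for all $x\in A_{\mathcal T^\perp}$. Moreover, $A_{\overline{\mathcal T}}$ is relatively open in $A$ and $A_{\overline{\mathcal T}}$ is locally well approximated by $\mathcal T$.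
   Context: $B(x,r)$ denotes the closed ball in $\mathbb{R}^n$ and $\overline A$ the closure of $A$. $\mathfrak C(0)$ is the collection of closed subsets of $\mathbb{R}^n$ containing $0$. For $A,B\subseteq\mathbb{R}^n$ with $B\neq\emptyset$, $\mathrm{ex}(A,B)=\sup_{a\in A}\inf_{b\in B}|a-b|$, with $\mathrm{ex}(\emptyset,B)=0$. Nonempty closed sets $A_i$ converge to a nonempty closed set $A$ (Attouch--Wets topology, which is metrizable), $A_i\to A$, if $\mathrm{ex}(A_i\cap B(0,r),A)\to0$ and $\mathrm{ex}(A\cap B(0,r),A_i)\to 0$ for all $r>0$. For $\mathcal S\subseteq\mathfrak C(0)$, $\overline{\mathcal S}$ is the closure of $\mathcal S$ in $\mathfrak C(0)$ in this topology. A local approximation class is a nonempty collection $\mathcal S\subseteq\mathfrak C(0)$ such that $\lambda S\in\mathcal S$ for all $S\in\mathcal S$, $\lambda>0$. For nonempty $A,B$ put $\widetilde{\mathrm D}^{x,r}[A,B]=\frac1r\max\{\mathrm{ex}(A\cap B(x,r),B),\mathrm{ex}(B\cap B(x,r),A)\}$, and $\Theta^{\mathcal S}_A(x,r)=\inf_{S\in\mathcal S}\widetilde{\mathrm D}^{x,r}[A,x+S]$. A set $A$ is locally well approximated by $\mathcal S$ if for every $\varepsilon>0$ and every compact $K\subseteq A$ there is $r_K>0$ such that $\Theta^{\mathcal S}_A(x,r)\leq\varepsilon$ for all $x\in K$ and $0<r\leq r_K$ (vacuous for the empty set). For closed $A$ and $x\in A$, $\Psi\text{-}\mathrm{Tan}(A,x)$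 is the collection of $T\in\mathfrak C(0)$ for which there exist $x_i\in A$, $r_i>0$ with $x_i\to x$, $r_i\to0$ and $(A-x_i)/r_i\to T$; $\mathrm{Tan}(A,x)$ is the subcollection of those $T$ for which one may take $x_i=x$ for all $i$. Singular class: $\mathcal T^\perp=\{D\in\mathfrak C(0):\liminf_{r\downarrow0}\Theta^{\mathcal T}_D(0,r)>0\}$ (equivalently, $\{D\in\mathfrak C(0):\mathrm{Tan}(D,0)\cap\overline{\mathcal T}=\emptyset\}$). $\mathcal T$ points are detectable in $\mathcal S$ if there exist a constant $\phi>0$ and a function $\Phi:(0,1)\to(0,\infty)$ with $\liminf_{s\to0+}\Phi(s)=0$ such that whenever $S\in\mathcal S$, $r>0$ and $\Theta^{\mathcal T}_S(0,r)<\phi$, then $\Theta^{\mathcal T}_S(0,sr)<\Phi(s)$ for all $s\in(0,1)$. *)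

theory Defs
  imports "HOL-Analysis.Analysis"
begin

definition excess :: "'a::euclidean_space set \<Rightarrow> 'a set \<Rightarrow> ennreal" where
  "excess A B = (SUP a\<in>A. INF b\<in>B. ennreal (dist a b))"
  \<comment> \<open>Valued in \<open>[0, \<infinity>]\<close>, so the supremum always exists, and it is 0 for empty A.
      Only used with B nonempty.\<close>

definition closed_sets0 :: "'a::euclidean_space set set" where
  "closed_sets0 = {A. closed A \<and> 0 \<in> A}"

definition aw_converges :: "(nat \<Rightarrow> 'a::euclidean_space set) \<Rightarrow> 'a set \<Rightarrow> bool" where
  "aw_converges X A \<longleftrightarrow> (\<forall>r>0.
     (\<lambda>i. excess (X i \<inter> cball 0 r) A) \<longlonglongrightarrow> 0 \<and>
     (\<lambda>i. excess (A \<inter> cball 0 r) (X i)) \<longlonglongrightarrow> 0)"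

definition nonempty_closed_sets :: "'a::euclidean_space set set" where
  "nonempty_closed_sets = {A. closed A \<and> A \<noteq> {}}"

text \<open>The Attouch--Wets topology is metrizable, hence determined by its convergent
  sequences: its open sets are the sequentially open ones. The lemmas
  \<open>limitin_attouch_wets\<close> and \<open>in_aw_closure_iff\<close> below confirm that
  convergence in this topology is \<open>aw_converges\<close> and that closures are sequential.\<close>

definition attouch_wets :: "'a::euclidean_space set topology" where
  "attouch_wets = topology (\<lambda>U. U \<subseteq> nonempty_closed_sets \<and>
     (\<forall>X A. A \<in> U \<longrightarrow> (\<forall>i. X i \<in> nonempty_closed_sets) \<longrightarrow> aw_converges X A \<longrightarrow>
        (\<forall>\<^sub>F i in sequentially. X i \<in> U)))"

definition aw_closure :: "'a::euclidean_space set set \<Rightarrow> 'a set set" where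
  "aw_closure \<S> = subtopology attouch_wets closed_sets0 closure_of \<S>"

definition local_approximation_class :: "'a::euclidean_space set set \<Rightarrow> bool" where
  "local_approximation_class \<S> \<longleftrightarrow> \<S> \<noteq> {} \<and> \<S> \<subseteq> closed_sets0 \<and>
     (\<forall>S\<in>\<S>. \<forall>c>0. (\<lambda>x. c *\<^sub>R x) ` S \<in> \<S>)"

definition rel_walkup_wets :: "'a::euclidean_space \<Rightarrow> real \<Rightarrow> 'a set \<Rightarrow> 'a set \<Rightarrow> ennreal" where
  "rel_walkup_wets x r A B =
     ennreal (1 / r) * max (excess (A \<inter> cball x r) B) (excess (B \<inter> cball x r) A)"

definition approximability ::
  "'a::euclidean_space set set \<Rightarrow> 'a set \<Rightarrow> 'a \<Rightarrow> real \<Rightarrow> ennreal" where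
  "approximability \<S> A x r = (INF S\<in>\<S>. rel_walkup_wets x r A ((\<lambda>y. x + y) ` S))"

definition locally_well_approximated ::
  "'a::euclidean_space set \<Rightarrow> 'a set set \<Rightarrow> bool" where
  "locally_well_approximated A \<S> \<longleftrightarrow>
     (\<forall>\<epsilon>>0. \<forall>K. compact K \<and> K \<subseteq> A \<longrightarrow>
        (\<exists>r\<^sub>K>0. \<forall>x\<in>K. \<forall>r. 0 < r \<and> r \<le> r\<^sub>K \<longrightarrow> approximability \<S> A x r \<le> ennreal \<epsilon>))"

definition pseudotangent_sets :: "'a::euclidean_space set \<Rightarrow> 'a \<Rightarrow> 'a set set" where
  "pseudotangent_sets A x = {T \<in> closed_sets0. \<exists>y r.
     (\<forall>i. y i \<in> A) \<and> (\<forall>i. r i > 0) \<and> y \<longlonglongrightarrow> x \<and> r \<longlonglongrightarrow> (0::real) \<and>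
     aw_converges (\<lambda>i. (\<lambda>a. (a - y i) /\<^sub>R r i) ` A) T}"

definition tangent_sets :: "'a::euclidean_space set \<Rightarrow> 'a \<Rightarrow> 'a set set" where
  "tangent_sets A x = {T \<in> closed_sets0. \<exists>r.
     (\<forall>i. r i > 0) \<and> r \<longlonglongrightarrow> (0::real) \<and>
     aw_converges (\<lambda>i. (\<lambda>a. (a - x) /\<^sub>R r i) ` A) T}"

definition singular_class :: "'a::euclidean_space set set \<Rightarrow> 'a set set" where
  "singular_class \<T> =
     {D \<in> closed_sets0. Liminf (at_right 0) (\<lambda>r. approximability \<T> D 0 r) > 0}"

definition detectable :: "'a::euclidean_space set set \<Rightarrow> 'a set set \<Rightarrow> bool" where
  "detectable \<T> \<S> \<longleftrightarrow> (\<exists>\<phi>>0. \<exists>\<Phi> :: real \<Rightarrow> real.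
     (\<forall>s\<in>{0<..<1}. \<Phi> s > 0) \<and>
     Liminf (at_right 0) (\<lambda>s. ereal (\<Phi> s)) = 0 \<and>
     (\<forall>S\<in>\<S>. \<forall>r>0. approximability \<T> S 0 r < ennreal \<phi> \<longrightarrow>
        (\<forall>s\<in>{0<..<1}. approximability \<T> S 0 (s * r) < ennreal (\<Phi> s))))"


subsection \<open>Adequacy of the topology\<close>

definition aw_near :: "real \<Rightarrow> real \<Rightarrow> 'a::euclidean_space set \<Rightarrow> 'a set \<Rightarrow> bool" where
  "aw_near r e A B \<longleftrightarrow> excess (A \<inter> cball 0 r) B < ennreal e \<and> excess (B \<inter> cball 0 r) A < ennreal e"

lemma openin_attouch_wets:
  "openin attouch_wets U \<longleftrightarrow> U \<subseteq> nonempty_closed_sets \<and>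
     (\<forall>X A. A \<in> U \<longrightarrow> (\<forall>i. X i \<in> nonempty_closed_sets) \<longrightarrow> aw_converges X A \<longrightarrow>
        (\<forall>\<^sub>F i in sequentially. X i \<in> U))"
proof -
  define P where "P = (\<lambda>U :: 'a set set. U \<subseteq> nonempty_closed_sets \<and>
     (\<forall>X A. A \<in> U \<longrightarrow> (\<forall>i. X i \<in> nonempty_closed_sets) \<longrightarrow> aw_converges X A \<longrightarrow>
        (\<forall>\<^sub>F i in sequentially. X i \<in> U)))"
  have "P (U \<inter> V)" if "P U" "P V" for U V
    using that unfolding P_def by (auto simp: eventually_conj_iff)
  moreover have "P (\<Union>\<U>)" if "\<forall>U\<in>\<U>. P U" for \<U>
    unfolding P_def
  proof (intro conjI allI impI)
    show "\<Union>\<U> \<subseteq> nonempty_closed_sets" using that unfolding P_def by blast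
    fix X A assume "A \<in> \<Union>\<U>" and X: "\<forall>i. X i \<in> nonempty_closed_sets" "aw_converges X A"
    then obtain U where "U \<in> \<U>" "A \<in> U" by blast
    with X that have "\<forall>\<^sub>F i in sequentially. X i \<in> U" unfolding P_def by blast
    then show "\<forall>\<^sub>F i in sequentially. X i \<in> \<Union>\<U>"
      by (rule eventually_mono) (use \<open>U \<in> \<U>\<close> in blast)
  qed
  ultimately have "istopology P" unfolding istopology_def by blast
  then show ?thesis
    unfolding attouch_wets_def P_def[symmetric] by (simp add: topology_inverse' P_def)
qed

lemma topspace_attouch_wets [simp]: "topspace attouch_wets = nonempty_closed_sets"
proof -
  have "openin attouch_wets nonempty_closed_sets" by (simp add: openin_attouch_wets)
  then show ?thesis
    using openin_attouch_wets[of "topspace attouch_wets"] openin_subset by fastforce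
qed

lemma excess_lessD:
  assumes "excess A B < ennreal e" "a \<in> A"
  obtains b where "b \<in> B" "dist a b < e"
proof -
  have "(INF b\<in>B. ennreal (dist a b)) < ennreal e"
    using assms unfolding excess_def by (meson SUP_lessD)
  then show ?thesis by (auto simp: INF_less_iff ennreal_less_iff intro: that)
qed

lemma excess_mono: "A \<subseteq> A' \<Longrightarrow> excess A B \<le> excess A' B"
  unfolding excess_def by (rule SUP_subset_mono) auto

lemma excess_triangle:
  assumes "excess (A \<inter> cball 0 (r + d)) B < ennreal d"
    and "excess (B \<inter> cball 0 (r + d)) C < ennreal d" and "d > 0"
  shows "excess (A \<inter> cball 0 r) C < ennreal (3 * d)"
proof -
  have "excess (A \<inter> cball 0 r) C \<le> ennreal (2 * d)"
    unfolding excess_def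
  proof (rule SUP_least)
    fix a assume a: "a \<in> A \<inter> cball 0 r"
    then have "a \<in> A \<inter> cball 0 (r + d)" using \<open>d > 0\<close> by auto
    then obtain b where b: "b \<in> B" "dist a b < d" by (rule excess_lessD[OF assms(1)])
    have "norm b \<le> norm a + dist a b" by norm
    then have "b \<in> B \<inter> cball 0 (r + d)" using a b by auto
    then obtain c where c: "c \<in> C" "dist b c < d" by (rule excess_lessD[OF assms(2)])
    have "dist a c \<le> 2 * d" using b c dist_triangle[of a c b] by simp
    then show "(INF b\<in>C. ennreal (dist a b)) \<le> ennreal (2 * d)"
      by (intro INF_lower2[OF c(1)] ennreal_leI)
  qed
  also have "\<dots> < ennreal (3 * d)" using \<open>d > 0\<close> by (intro ennreal_lessI) auto
  finally show ?thesis .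
qed

lemma aw_near_triangle:
  "\<lbrakk>aw_near (r + d) d A B; aw_near (r + d) d B C; d > 0\<rbrakk> \<Longrightarrow> aw_near r (3 * d) A C"
  unfolding aw_near_def by (blast intro: excess_triangle)

lemma aw_near_mono:
  assumes "aw_near r e A B" "r' \<le> r" "e \<le> e'"
  shows "aw_near r' e' A B"
proof -
  have *: "excess (C \<inter> cball 0 r') D < ennreal e'" if "excess (C \<inter> cball 0 r) D < ennreal e" for C D :: "'a set"
  proof -
    have "C \<inter> cball 0 r' \<subseteq> C \<inter> cball 0 r" using assms(2) by auto
    from excess_mono[OF this] that ennreal_leI[OF assms(3)] show ?thesis
      by (meson le_less_trans less_le_trans)
  qed
  show ?thesis using assms(1) unfolding aw_near_def by (blast intro: *)
qed

lemma excess_self: "A \<subseteq> B \<Longrightarrow> excess A B = 0"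
proof -
  assume "A \<subseteq> B"
  have "excess A B \<le> 0" unfolding excess_def
  proof (rule SUP_least)
    fix a assume "a \<in> A"
    with \<open>A \<subseteq> B\<close> have "a \<in> B" by blast
    then show "(INF b\<in>B. ennreal (dist a b)) \<le> 0" by (rule INF_lower2) simp
  qed
  then show ?thesis by simp
qed

lemma aw_near_refl: "e > 0 \<Longrightarrow> aw_near r e A A"
  by (simp add: aw_near_def excess_self)

lemma tendsto_zero_ennreal_iff:
  fixes f :: "nat \<Rightarrow> ennreal"
  shows "f \<longlonglongrightarrow> 0 \<longleftrightarrow> (\<forall>e>0. \<forall>\<^sub>F i in sequentially. f i < ennreal e)"
proof
  assume "f \<longlonglongrightarrow> 0"
  then show "\<forall>e>0. \<forall>\<^sub>F i in sequentially. f i < ennreal e" by (auto intro: order_tendstoD)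
next
  assume *: "\<forall>e>0. \<forall>\<^sub>F i in sequentially. f i < ennreal e"
  show "f \<longlonglongrightarrow> 0"
  proof (rule order_tendstoI)
    fix a :: ennreal assume "0 < a"
    then obtain b where b: "0 < b" "b < a" using dense by blast
    then have "b < top" using order_less_le_trans top_greatest by blast
    with b have "ennreal (enn2real b) = b" "enn2real b > 0" by (simp_all add: enn2real_positive_iff)
    with * have "\<forall>\<^sub>F i in sequentially. f i < b" by metis
    then show "\<forall>\<^sub>F i in sequentially. f i < a" by (rule eventually_mono) (use b in auto)
  qed simp
qed

lemma aw_converges_iff_near:
  "aw_converges X A \<longleftrightarrow> (\<forall>r>0. \<forall>e>0. \<forall>\<^sub>F i in sequentially. aw_near r e A (X i))"
  unfolding aw_converges_def tendsto_zero_ennreal_iff aw_near_def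
  by (auto simp: eventually_conj_iff)

lemma aw_converges_if_near_Suc:
  assumes "\<And>n. aw_near (Suc n) (1 / Suc n) A (X n)"
  shows "aw_converges X A"
  unfolding aw_converges_iff_near
proof (intro allI impI)
  fix r e :: real assume "r > 0" "e > 0"
  have "\<forall>\<^sub>F n in sequentially. r \<le> real (Suc n)"
    by (rule eventually_sequentiallyI[of "nat \<lceil>r\<rceil>"]) linarith
  moreover have "\<forall>\<^sub>F n in sequentially. 1 / real (Suc n) \<le> e"
  proof -
    have "\<forall>\<^sub>F n in sequentially. inverse (real (Suc n)) < e"
      by (rule order_tendstoD(2)[OF LIMSEQ_inverse_real_of_nat \<open>e > 0\<close>])
    then show ?thesis by (rule eventually_mono) (simp add: inverse_eq_divide)
  qed
  ultimately show "\<forall>\<^sub>F n in sequentially. aw_near r e A (X n)"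
    by eventually_elim (rule aw_near_mono[OF assms])
qed

lemma openin_attouch_wets_iff_near:
  "openin attouch_wets U \<longleftrightarrow> U \<subseteq> nonempty_closed_sets \<and>
     (\<forall>A\<in>U. \<exists>r>0. \<exists>e>0. \<forall>B\<in>nonempty_closed_sets. aw_near r e A B \<longrightarrow> B \<in> U)"
  (is "_ \<longleftrightarrow> _ \<and> ?R")
proof (cases "U \<subseteq> nonempty_closed_sets")
  case True
  have ?R if op: "openin attouch_wets U"
  proof (rule ccontr)
    assume "\<not> ?R"
    then obtain A where A: "A \<in> U"
      "\<And>r e. r > 0 \<Longrightarrow> e > 0 \<Longrightarrow> \<exists>B\<in>nonempty_closed_sets. aw_near r e A B \<and> B \<notin> U"
      by blast
    have "\<forall>n. \<exists>B\<in>nonempty_closed_sets. aw_near (Suc n) (1 / Suc n) A B \<and> B \<notin> U"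
      by (intro allI A(2)) auto
    then obtain X where X: "\<And>n. X n \<in> nonempty_closed_sets"
      "\<And>n. aw_near (Suc n) (1 / Suc n) A (X n)" "\<And>n. X n \<notin> U" by metis
    have "\<forall>\<^sub>F n in sequentially. X n \<in> U"
      using op A(1) X(1) aw_converges_if_near_Suc[OF X(2)] unfolding openin_attouch_wets by blast
    with X(3) show False by simp
  qed
  moreover have "openin attouch_wets U" if ?R
    unfolding openin_attouch_wets
  proof (intro conjI allI impI)
    fix X A assume X: "A \<in> U" "\<forall>i. X i \<in> nonempty_closed_sets" "aw_converges X A"
    from X(1) \<open>?R\<close> obtain r e where *: "r > 0" "e > 0"
      "\<forall>B\<in>nonempty_closed_sets. aw_near r e A B \<longrightarrow> B \<in> U" by blast
    then have "\<forall>\<^sub>F i in sequentially. aw_near r e A (X i)"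
      using X(3) unfolding aw_converges_iff_near by blast
    then show "\<forall>\<^sub>F i in sequentially. X i \<in> U"
      by (rule eventually_mono) (use X(2) * in blast)
  qed (rule True)
  ultimately show ?thesis using True by blast
qed (simp add: openin_attouch_wets)

lemma aw_near_neighbourhood:
  assumes "A \<in> nonempty_closed_sets" "r > 0" "e > 0"
  obtains W where "openin attouch_wets W" "A \<in> W" "\<And>B. B \<in> W \<Longrightarrow> aw_near r e A B"
proof
  let ?N = "\<lambda>B. \<exists>s>0. \<exists>f>0. \<forall>C\<in>nonempty_closed_sets. aw_near s f B C \<longrightarrow> aw_near r e A C"
  let ?W = "{B \<in> nonempty_closed_sets. ?N B}"
  show "A \<in> ?W" using assms by blast
  show "aw_near r e A B" if "B \<in> ?W" for B using that aw_near_refl by blast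
  show "openin attouch_wets ?W" unfolding openin_attouch_wets_iff_near
  proof (intro conjI ballI)
    fix B assume "B \<in> ?W"
    then obtain s f where sf: "s > 0" "f > 0"
      "\<And>C. C \<in> nonempty_closed_sets \<Longrightarrow> aw_near s f B C \<Longrightarrow> aw_near r e A C" by blast
    define d where "d = f / 3"
    have d: "d > 0" "3 * d = f" "s + d > 0" using sf by (auto simp: d_def)
    have "B' \<in> ?W" if B': "B' \<in> nonempty_closed_sets" "aw_near (s + d) d B B'" for B'
    proof -
      have "aw_near r e A C" if "C \<in> nonempty_closed_sets" "aw_near (s + d) d B' C" for C
        using aw_near_triangle[OF B'(2) that(2) d(1)] that(1) sf(3) d(2) by simp
      with B'(1) d show ?thesis by blast
    qed
    with d show "\<exists>s>0. \<exists>f>0. \<forall>C\<in>nonempty_closed_sets. aw_near s f B C \<longrightarrow> C \<in> ?W" by blast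
  qed blast
qed

lemma limitin_attouch_wets:
  assumes "\<And>i. X i \<in> nonempty_closed_sets"
  shows "limitin attouch_wets X A sequentially \<longleftrightarrow> A \<in> nonempty_closed_sets \<and> aw_converges X A"
proof
  assume L: "limitin attouch_wets X A sequentially"
  then have A: "A \<in> nonempty_closed_sets" by (simp add: limitin_def)
  moreover have "\<forall>\<^sub>F i in sequentially. aw_near r e A (X i)" if re: "r > 0" "e > 0" for r e
  proof -
    obtain W where W: "openin attouch_wets W" "A \<in> W" "\<And>B. B \<in> W \<Longrightarrow> aw_near r e A B"
      using aw_near_neighbourhood[OF A re] by blast
    with L have "\<forall>\<^sub>F i in sequentially. X i \<in> W" by (simp add: limitin_def)
    then show ?thesis by (rule eventually_mono) (rule W(3))
  qed
  ultimately show "A \<in> nonempty_closed_sets \<and> aw_converges X A"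
    by (simp add: aw_converges_iff_near)
next
  assume "A \<in> nonempty_closed_sets \<and> aw_converges X A"
  then show "limitin attouch_wets X A sequentially"
    using assms unfolding limitin_def openin_attouch_wets by auto
qed

lemma in_aw_closure_iff:
  assumes "\<S> \<subseteq> closed_sets0"
  shows "A \<in> aw_closure \<S> \<longleftrightarrow> A \<in> closed_sets0 \<and> (\<exists>X. (\<forall>i. X i \<in> \<S>) \<and> aw_converges X A)"
proof -
  have sub: "(closed_sets0 :: 'a set set) \<subseteq> nonempty_closed_sets"
    by (auto simp: closed_sets0_def nonempty_closed_sets_def)
  have cl: "A \<in> aw_closure \<S> \<longleftrightarrow> A \<in> closed_sets0 \<and>
      (\<forall>W. A \<in> W \<and> openin attouch_wets W \<longrightarrow> (\<exists>S\<in>\<S>. S \<in> W))"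
    (is "_ \<longleftrightarrow> _ \<and> ?R")
  proof -
    have "topspace (subtopology attouch_wets closed_sets0) = (closed_sets0 :: 'a set set)"
      using sub by auto
    then have "A \<in> aw_closure \<S> \<longleftrightarrow> A \<in> closed_sets0 \<and>
      (\<forall>W. A \<in> W \<inter> closed_sets0 \<and> openin attouch_wets W \<longrightarrow> (\<exists>S\<in>\<S>. S \<in> W \<inter> closed_sets0))"
      unfolding aw_closure_def in_closure_of openin_subtopology by (simp only:) blast
    then show ?thesis using assms by blast
  qed
  show ?thesis
  proof
    assume A: "A \<in> aw_closure \<S>"
    have "\<exists>S\<in>\<S>. aw_near (Suc n) (1 / Suc n) A S" for n
    proof -
      obtain W where "openin attouch_wets W" "A \<in> W" "\<And>B. B \<in> W \<Longrightarrow> aw_near (Suc n) (1 / Suc n) A B"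
      proof (rule aw_near_neighbourhood[of A "Suc n" "1 / Suc n"])
        show "A \<in> nonempty_closed_sets" using A cl sub by blast
      qed simp_all
      with A[unfolded cl] show ?thesis by meson
    qed
    then obtain X where "\<And>n. X n \<in> \<S>" "\<And>n. aw_near (Suc n) (1 / Suc n) A (X n)" by metis
    then have "(\<forall>i. X i \<in> \<S>) \<and> aw_converges X A"
      by (simp add: aw_converges_if_near_Suc)
    then show "A \<in> closed_sets0 \<and> (\<exists>X. (\<forall>i. X i \<in> \<S>) \<and> aw_converges X A)"
      using A[unfolded cl] by blast
  next
    assume "A \<in> closed_sets0 \<and> (\<exists>X. (\<forall>i. X i \<in> \<S>) \<and> aw_converges X A)"
    then obtain X where X: "A \<in> closed_sets0" "\<And>i. X i \<in> \<S>" "aw_converges X A" by blast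
    have "\<exists>S\<in>\<S>. S \<in> W" if W: "A \<in> W" "openin attouch_wets W" for W
    proof -
      have "\<forall>\<^sub>F i in sequentially. X i \<in> W"
        using W(2)[unfolded openin_attouch_wets] W(1) X(3) X(2) sub assms by (meson subsetD)
      then obtain i where "X i \<in> W" unfolding eventually_sequentially by blast
      with X(2) show ?thesis by blast
    qed
    with X(1) show "A \<in> aw_closure \<S>" unfolding cl by blast
  qed
qed

end

theory Submission
  imports Defs
begin

text \<open>
  The singular part \<open>A\<^sub>P\<close> and the part \<open>A\<^sub>T\<close> are separated by a gap. Detectability says that
  for a member of \<open>\<S>\<close>, being moderately close to \<open>\<T>\<close> at one scale forces it to be as close as
  desired at some smaller scale. This passes to \<open>A\<close>: at a point where \<open>A\<close> is very close to \<open>\<S>\<close> at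
  scale \<open>r\<close> and \<open>\<phi>\<close>-close to \<open>\<T>\<close> at scale \<open>r\<close>, compare \<open>A\<close> with a member of \<open>\<S>\<close>, apply
  detectability to that member, and compare back (\<open>detectable_step\<close>). With target closeness
  \<open>\<phi>\<close> the step can be repeated along a geometric sequence of scales, and one further step with
  a finer target reaches any prescribed closeness (\<open>detectable_propagation\<close>). Hence at every
  point of \<open>A\<close> either the approximability by \<open>\<T>\<close> tends to 0 as the scale shrinks, or
  \<open>\<phi>\<close>-closeness to \<open>\<T>\<close> fails at every small scale. The first alternative defines \<open>A\<^sub>T\<close>.

  Closeness at a single scale is stable under moving the base point, and the scales at which
  propagation starts to work depend only on how well \<open>\<S>\<close> approximates \<open>A\<close>, which is uniform on
  compact sets. So along a sequence in \<open>A\<close> converging to a point of \<open>A\<^sub>T\<close>, all but finitely many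
  terms are approximated by \<open>\<T>\<close> with a common rate (\<open>uniformly_approximated_tail\<close>). Three
  conclusions follow from this one fact: \<open>A\<^sub>T\<close> is relatively open, the approximation by \<open>\<T>\<close> is
  uniform on compact subsets of \<open>A\<^sub>T\<close>, and pseudotangent sets at points of \<open>A\<^sub>T\<close> lie in the
  closure of \<open>\<T>\<close>. For the last one, the base points, which are only in the closure of \<open>A\<close>, are
  first moved into \<open>A\<close> by an amount negligible against the scale. At the remaining points, the
  failure of \<open>\<phi>\<close>-closeness at every small scale becomes, after blowing up, a lower bound at
  every scale for each tangent set.
\<close>

section \<open>Two-sided closeness on balls around the origin\<close>

text \<open>
  A real-valued substitute for a bound on the two excesses in a ball. The error \<open>e\<close> is absolute,
  not divided by the radius, so that one may shrink \<open>\<rho>\<close> without changing \<open>e\<close>.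
\<close>

definition near_in :: "real \<Rightarrow> real \<Rightarrow> 'a::euclidean_space set \<Rightarrow> 'a set \<Rightarrow> bool" where
  "near_in \<rho> e A B \<longleftrightarrow>
     (\<forall>a\<in>A. norm a \<le> \<rho> \<longrightarrow> (\<exists>b\<in>B. dist a b < e)) \<and>
     (\<forall>b\<in>B. norm b \<le> \<rho> \<longrightarrow> (\<exists>a\<in>A. dist b a < e))"

lemma near_in_sym: "near_in \<rho> e A B \<Longrightarrow> near_in \<rho> e B A"
  by (auto simp: near_in_def)

lemma near_in_mono:
  assumes "near_in \<rho> e A B" "\<rho>' \<le> \<rho>" "e \<le> e'"
  shows "near_in \<rho>' e' A B"
proof -
  have "dist u v < e \<Longrightarrow> dist u v < e'" "norm u \<le> \<rho>' \<Longrightarrow> norm u \<le> \<rho>" for u v :: 'a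
    using assms(2,3) by auto
  then show ?thesis using assms(1) unfolding near_in_def by meson
qed

text \<open>
  The witness in \<open>B\<close> for a point of the \<open>\<rho>\<close>-ball may leave that ball by as much as the error,
  which is why the radii of the two hypotheses have to exceed \<open>\<rho>\<close>.
\<close>

lemma near_in_trans:
  assumes AB: "near_in \<rho>\<^sub>1 e\<^sub>1 A B" and BC: "near_in \<rho>\<^sub>2 e\<^sub>2 B C"
    and "\<rho> \<le> \<rho>\<^sub>1" "\<rho> + e\<^sub>1 \<le> \<rho>\<^sub>2" "\<rho> \<le> \<rho>\<^sub>2" "\<rho> + e\<^sub>2 \<le> \<rho>\<^sub>1"
  shows "near_in \<rho> (e\<^sub>1 + e\<^sub>2) A C"
proof -
  have one_sided: "\<exists>c\<in>C. dist a c < d + d'"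
    if h: "\<forall>a\<in>A. norm a \<le> \<sigma> \<longrightarrow> (\<exists>b\<in>B. dist a b < d)"
      "\<forall>b\<in>B. norm b \<le> \<sigma>' \<longrightarrow> (\<exists>c\<in>C. dist b c < d')"
      "\<rho> \<le> \<sigma>" "\<rho> + d \<le> \<sigma>'" "a \<in> A" "norm a \<le> \<rho>"
    for A B C :: "'a set" and a \<sigma> \<sigma>' d d'
  proof -
    obtain b where b: "b \<in> B" "dist a b < d" using h(1)[rule_format, of a] h(3,5,6) by auto
    have "norm b \<le> norm a + dist a b" by norm
    with b h have "norm b \<le> \<sigma>'" by linarith
    then obtain c where c: "c \<in> C" "dist b c < d'" using h(2) b by blast
    have "dist a c < d + d'" using b c dist_triangle[of a c b] by linarith
    with c show ?thesis by blast
  qed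
  show ?thesis
    using one_sided[of A \<rho>\<^sub>1 B e\<^sub>1 \<rho>\<^sub>2 C e\<^sub>2] one_sided[of C \<rho>\<^sub>2 B e\<^sub>2 \<rho>\<^sub>1 A e\<^sub>1] assms
    unfolding near_in_def by (simp add: add.commute)
qed

lemma near_in_scaleR:
  assumes "near_in \<rho> e A B" "c > 0"
  shows "near_in (c * \<rho>) (c * e) ((*\<^sub>R) c ` A) ((*\<^sub>R) c ` B)"
proof -
  have d: "dist (c *\<^sub>R u) (c *\<^sub>R v) = c * dist u v" for u v :: 'a
    using \<open>c > 0\<close> by (simp add: dist_norm flip: scaleR_diff_right)
  show ?thesis using assms unfolding near_in_def by (simp add: d)
qed

definition recenter :: "'a::euclidean_space set \<Rightarrow> 'a \<Rightarrow> 'a set" where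
  "recenter A x = (\<lambda>a. a - x) ` A"

text \<open>
  Moving the base point, and passing between a set and its closure, are both covered by letting
  \<open>B\<close> be any set between \<open>A\<close> and \<open>closure A\<close>.
\<close>

lemma near_in_recenter_dense:
  assumes "A \<subseteq> B" "B \<subseteq> closure A" "dist x y < d"
  shows "near_in \<rho> d (recenter A x) (recenter B y)"
  unfolding near_in_def recenter_def
proof (intro conjI ballI impI)
  fix u assume "u \<in> (\<lambda>a. a - x) ` A"
  then obtain a where a: "a \<in> A" "u = a - x" by blast
  have "dist u (a - y) < d" using a assms(3) by (simp add: dist_norm norm_minus_commute)
  with a assms(1) show "\<exists>v\<in>(\<lambda>a. a - y) ` B. dist u v < d" by blast
next
  fix v assume "v \<in> (\<lambda>a. a - y) ` B"
  then obtain b where b: "b \<in> B" "v = b - y" by blast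
  obtain a where a: "a \<in> A" "dist a b < d - dist x y"
    using b assms(2,3) closure_approachable[of b A] by (meson diff_gt_0_iff_gt subsetD)
  have "dist v (a - x) \<le> dist a b + dist x y" unfolding b by norm
  with a show "\<exists>u\<in>(\<lambda>a. a - x) ` A. dist v u < d" by force
qed

lemma excess_leI:
  assumes "\<And>a. a \<in> A \<Longrightarrow> \<exists>b\<in>B. dist a b < e"
  shows "excess A B \<le> ennreal e"
  unfolding excess_def
proof (rule SUP_least)
  fix a assume "a \<in> A"
  then obtain b where "b \<in> B" "dist a b < e" using assms by blast
  then show "(INF b\<in>B. ennreal (dist a b)) \<le> ennreal e"
    by (intro INF_lower2[of b]) (auto intro: ennreal_leI)
qed

lemma near_in_if_aw_near:
  assumes "aw_near \<rho> e A B" shows "near_in \<rho> e A B"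
proof -
  have "\<exists>b\<in>D. dist a b < e" if "excess (C \<inter> cball 0 \<rho>) D < ennreal e" "a \<in> C" "norm a \<le> \<rho>"
    for C D :: "'a set" and a
    using that(2,3) by (auto intro: excess_lessD[OF that(1), of a])
  with assms show ?thesis unfolding aw_near_def near_in_def by metis
qed

lemma aw_near_if_near_in:
  assumes "near_in \<rho> e A B" "e < e'" "0 < e'"
  shows "aw_near \<rho> e' A B"
proof -
  have "excess (A \<inter> cball 0 \<rho>) B \<le> ennreal e" "excess (B \<inter> cball 0 \<rho>) A \<le> ennreal e"
    using assms(1) unfolding near_in_def by (auto intro!: excess_leI)
  moreover have "ennreal e < ennreal e'" using assms by (intro ennreal_lessI) auto
  ultimately show ?thesis unfolding aw_near_def by (meson le_less_trans)
qed

lemma near_in_if_rel_walkup_wets_less: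
  assumes "rel_walkup_wets x r A ((\<lambda>y. x + y) ` S) < ennreal e" "r > 0"
  shows "near_in r (e * r) (recenter A x) S"
proof -
  have less: "m < ennreal (e * r)" if "ennreal (1 / r) * m < ennreal e" for m
  proof (rule ccontr)
    assume "\<not> m < ennreal (e * r)"
    then have "ennreal (1 / r) * ennreal (e * r) \<le> ennreal (1 / r) * m"
      by (intro mult_left_mono) auto
    moreover have "ennreal (1 / r) * ennreal (e * r) = ennreal e"
      using \<open>r > 0\<close> by (simp add: ennreal_mult'[symmetric])
    ultimately show False using that by simp
  qed
  have "excess (A \<inter> cball x r) ((\<lambda>y. x + y) ` S) < ennreal (e * r)"
    "excess ((\<lambda>y. x + y) ` S \<inter> cball x r) A < ennreal (e * r)"
    using less[OF assms(1)[unfolded rel_walkup_wets_def]] by simp_all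
  note E = this
  show ?thesis unfolding near_in_def recenter_def
  proof (intro conjI ballI impI)
    fix u assume "u \<in> (\<lambda>a. a - x) ` A" "norm u \<le> r"
    then obtain a where a: "a \<in> A" "u = a - x" "a \<in> A \<inter> cball x r"
      by (auto simp: dist_norm norm_minus_commute)
    obtain b where "b \<in> (\<lambda>y. x + y) ` S" "dist a b < e * r" by (rule excess_lessD[OF E(1) a(3)])
    then obtain s where "s \<in> S" "dist a (x + s) < e * r" by blast
    moreover have "dist u s = dist a (x + s)" unfolding a(2) by (simp add: dist_norm algebra_simps)
    ultimately show "\<exists>b\<in>S. dist u b < e * r" by metis
  next
    fix s assume "s \<in> S" "norm s \<le> r"
    then have "x + s \<in> (\<lambda>y. x + y) ` S \<inter> cball x r" by (auto simp: dist_norm)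
    then obtain a where "a \<in> A" "dist (x + s) a < e * r" by (rule excess_lessD[OF E(2)])
    moreover have "dist s (a - x) = dist (x + s) a" by (simp add: dist_norm algebra_simps)
    ultimately show "\<exists>a\<in>(\<lambda>a. a - x) ` A. dist s a < e * r" by (metis imageI)
  qed
qed

lemma rel_walkup_wets_le_if_near_in:
  assumes "near_in r (e * r) (recenter A x) S" "r > 0"
  shows "rel_walkup_wets x r A ((\<lambda>y. x + y) ` S) \<le> ennreal e"
proof -
  have "excess (A \<inter> cball x r) ((\<lambda>y. x + y) ` S) \<le> ennreal (e * r)"
  proof (rule excess_leI)
    fix a assume "a \<in> A \<inter> cball x r"
    then have "a - x \<in> recenter A x" "norm (a - x) \<le> r"
      by (auto simp: recenter_def dist_norm norm_minus_commute)
    then obtain s where s: "s \<in> S" "dist (a - x) s < e * r"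
      using assms(1) unfolding near_in_def by blast
    moreover have "dist (a - x) s = dist a (x + s)" by (simp add: dist_norm algebra_simps)
    ultimately show "\<exists>b\<in>(\<lambda>y. x + y) ` S. dist a b < e * r" by auto
  qed
  moreover have "excess ((\<lambda>y. x + y) ` S \<inter> cball x r) A \<le> ennreal (e * r)"
  proof (rule excess_leI)
    fix b assume "b \<in> (\<lambda>y. x + y) ` S \<inter> cball x r"
    then obtain s where s: "s \<in> S" "b = x + s" "norm s \<le> r" by (auto simp: dist_norm)
    then obtain a where a: "a \<in> A" "dist s (a - x) < e * r"
      using assms(1) unfolding near_in_def recenter_def by blast
    moreover have "dist s (a - x) = dist b a" by (simp add: s(2) dist_norm algebra_simps)
    ultimately show "\<exists>a\<in>A. dist b a < e * r" by auto
  qed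
  ultimately have "rel_walkup_wets x r A ((\<lambda>y. x + y) ` S) \<le> ennreal (1 / r) * ennreal (e * r)"
    unfolding rel_walkup_wets_def by (intro mult_left_mono) auto
  also have "\<dots> = ennreal e" using \<open>r > 0\<close> by (simp add: ennreal_mult'[symmetric])
  finally show ?thesis .
qed


section \<open>Approximability as closeness to one member of the class\<close>

definition approx_in :: "'a::euclidean_space set set \<Rightarrow> 'a set \<Rightarrow> real \<Rightarrow> real \<Rightarrow> bool" where
  "approx_in \<T> B \<rho> e \<longleftrightarrow> (\<exists>S\<in>\<T>. near_in \<rho> e B S)"

lemma approx_in_mono:
  assumes "approx_in \<T> B \<rho> e" "\<rho>' \<le> \<rho>" "e \<le> e'"
  shows "approx_in \<T> B \<rho>' e'"
  using assms(1) near_in_mono[OF _ assms(2,3)] unfolding approx_in_def by blast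

lemma approx_in_trans:
  assumes "near_in \<rho>\<^sub>1 e\<^sub>1 A B" "approx_in \<T> B \<rho>\<^sub>2 e\<^sub>2"
    and "\<rho> \<le> \<rho>\<^sub>1" "\<rho> + e\<^sub>1 \<le> \<rho>\<^sub>2" "\<rho> \<le> \<rho>\<^sub>2" "\<rho> + e\<^sub>2 \<le> \<rho>\<^sub>1"
  shows "approx_in \<T> A \<rho> (e\<^sub>1 + e\<^sub>2)"
proof -
  obtain S where "S \<in> \<T>" "near_in \<rho>\<^sub>2 e\<^sub>2 B S" using assms(2) unfolding approx_in_def by blast
  with near_in_trans[OF assms(1) _ assms(3-6)] show ?thesis unfolding approx_in_def by blast
qed

lemma approx_in_scaleR:
  assumes "local_approximation_class \<T>" "c > 0" "approx_in \<T> B \<rho> e"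
  shows "approx_in \<T> ((*\<^sub>R) c ` B) (c * \<rho>) (c * e)"
proof -
  obtain S where S: "S \<in> \<T>" "near_in \<rho> e B S" using assms(3) unfolding approx_in_def by blast
  have "(*\<^sub>R) c ` S \<in> \<T>" using assms(1,2) S(1) unfolding local_approximation_class_def by blast
  with near_in_scaleR[OF S(2) \<open>c > 0\<close>] show ?thesis unfolding approx_in_def by blast
qed

lemma approx_in_if_approximability_less:
  assumes "approximability \<T> A x r < ennreal e" "r > 0"
  shows "approx_in \<T> (recenter A x) r (e * r)"
proof -
  obtain S where "S \<in> \<T>" "rel_walkup_wets x r A ((\<lambda>y. x + y) ` S) < ennreal e"
    using assms(1) unfolding approximability_def INF_less_iff by blast
  then show ?thesis
    unfolding approx_in_def using near_in_if_rel_walkup_wets_less[OF _ assms(2)] by blast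
qed

lemma approximability_le_if_approx_in:
  assumes "approx_in \<T> (recenter A x) r (e * r)" "r > 0"
  shows "approximability \<T> A x r \<le> ennreal e"
proof -
  obtain S where "S \<in> \<T>" "near_in r (e * r) (recenter A x) S"
    using assms(1) unfolding approx_in_def by blast
  then show ?thesis unfolding approximability_def
    by (intro INF_lower2[of S] rel_walkup_wets_le_if_near_in assms)
qed

lemma recenter_0 [simp]: "recenter A 0 = A"
  by (simp add: recenter_def)

text \<open>
  One rate for all base points in \<open>Y\<close>. Local good approximation is this property on compact
  subsets; having it for arbitrary \<open>Y\<close> allows the use of single points and of tails of sequences.
\<close>

definition uniformly_approximated ::
  "'a::euclidean_space set set \<Rightarrow> 'a set \<Rightarrow> 'a set \<Rightarrow> bool" where
  "uniformly_approximated \<S> A Y \<longleftrightarrow>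
     (\<forall>\<epsilon>>0. \<exists>r>0. \<forall>x\<in>Y. \<forall>\<rho>. 0 < \<rho> \<and> \<rho> \<le> r \<longrightarrow> approx_in \<S> (recenter A x) \<rho> (\<epsilon> * \<rho>))"

lemma uniformly_approximatedD:
  assumes "uniformly_approximated \<S> A Y" "\<epsilon> > 0"
  obtains r where "r > 0"
    "\<And>x \<rho>. \<lbrakk>x \<in> Y; 0 < \<rho>; \<rho> \<le> r\<rbrakk> \<Longrightarrow> approx_in \<S> (recenter A x) \<rho> (\<epsilon> * \<rho>)"
proof -
  from assms obtain r where "r > 0"
    "\<forall>x\<in>Y. \<forall>\<rho>. 0 < \<rho> \<and> \<rho> \<le> r \<longrightarrow> approx_in \<S> (recenter A x) \<rho> (\<epsilon> * \<rho>)"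
    unfolding uniformly_approximated_def by meson
  then show ?thesis by (intro that[of r]) simp_all
qed

lemma uniformly_approximated_singletonD:
  assumes "uniformly_approximated \<S> A {x}" "\<epsilon> > 0"
  obtains r where "r > 0" "\<And>\<rho>. \<lbrakk>0 < \<rho>; \<rho> \<le> r\<rbrakk> \<Longrightarrow> approx_in \<S> (recenter A x) \<rho> (\<epsilon> * \<rho>)"
proof -
  obtain r where "r > 0"
    "\<And>z \<rho>. \<lbrakk>z \<in> {x}; 0 < \<rho>; \<rho> \<le> r\<rbrakk> \<Longrightarrow> approx_in \<S> (recenter A z) \<rho> (\<epsilon> * \<rho>)"
    using uniformly_approximatedD[OF assms] by blast
  then show ?thesis by (intro that[of r]) simp_all
qed

lemma uniformly_approximated_subset:
  assumes "uniformly_approximated \<S> A Y" "Z \<subseteq> Y"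
  shows "uniformly_approximated \<S> A Z"
  unfolding uniformly_approximated_def
proof (intro allI impI)
  fix \<epsilon> :: real assume "\<epsilon> > 0"
  obtain r where "r > 0"
    "\<And>x \<rho>. \<lbrakk>x \<in> Y; 0 < \<rho>; \<rho> \<le> r\<rbrakk> \<Longrightarrow> approx_in \<S> (recenter A x) \<rho> (\<epsilon> * \<rho>)"
    using uniformly_approximatedD[OF assms(1) \<open>\<epsilon> > 0\<close>] by blast
  with assms(2)
  show "\<exists>r>0. \<forall>x\<in>Z. \<forall>\<rho>. 0 < \<rho> \<and> \<rho> \<le> r \<longrightarrow> approx_in \<S> (recenter A x) \<rho> (\<epsilon> * \<rho>)"
    by (intro exI[of _ r]) (simp add: subset_iff)
qed

lemma locally_well_approximated_iff:
  "locally_well_approximated A \<S> \<longleftrightarrow>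
     (\<forall>K. compact K \<and> K \<subseteq> A \<longrightarrow> uniformly_approximated \<S> A K)"
proof
  assume L: "locally_well_approximated A \<S>"
  show "\<forall>K. compact K \<and> K \<subseteq> A \<longrightarrow> uniformly_approximated \<S> A K"
    unfolding uniformly_approximated_def
  proof (intro allI impI)
    fix K and \<epsilon> :: real assume K: "compact K \<and> K \<subseteq> A" "\<epsilon> > 0"
    obtain r where r: "r > 0"
      "\<And>x \<rho>. \<lbrakk>x \<in> K; 0 < \<rho>; \<rho> \<le> r\<rbrakk> \<Longrightarrow> approximability \<S> A x \<rho> \<le> ennreal (\<epsilon> / 2)"
      using L[unfolded locally_well_approximated_def, rule_format, OF half_gt_zero[OF K(2)] K(1)] by blast
    have "ennreal (\<epsilon> / 2) < ennreal \<epsilon>" using K(2) by (intro ennreal_lessI) auto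
    with r(2) have "\<And>x \<rho>. \<lbrakk>x \<in> K; 0 < \<rho>; \<rho> \<le> r\<rbrakk> \<Longrightarrow> approximability \<S> A x \<rho> < ennreal \<epsilon>"
      using le_less_trans by blast
    then show "\<exists>r>0. \<forall>x\<in>K. \<forall>\<rho>. 0 < \<rho> \<and> \<rho> \<le> r \<longrightarrow> approx_in \<S> (recenter A x) \<rho> (\<epsilon> * \<rho>)"
      using r(1) by (intro exI[of _ r]) (simp add: approx_in_if_approximability_less)
  qed
next
  assume "\<forall>K. compact K \<and> K \<subseteq> A \<longrightarrow> uniformly_approximated \<S> A K"
  then show "locally_well_approximated A \<S>"
    unfolding locally_well_approximated_def
  proof (intro allI impI)
    fix K and \<epsilon> :: real assume K: "compact K \<and> K \<subseteq> A" "\<epsilon> > 0"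
    with \<open>\<forall>K. compact K \<and> K \<subseteq> A \<longrightarrow> uniformly_approximated \<S> A K\<close>
    have UA: "uniformly_approximated \<S> A K" by simp
    obtain r where "r > 0"
      "\<And>x \<rho>. \<lbrakk>x \<in> K; 0 < \<rho>; \<rho> \<le> r\<rbrakk> \<Longrightarrow> approx_in \<S> (recenter A x) \<rho> (\<epsilon> * \<rho>)"
      using uniformly_approximatedD[OF UA K(2)] by blast
    then show "\<exists>r>0. \<forall>x\<in>K. \<forall>\<rho>. 0 < \<rho> \<and> \<rho> \<le> r \<longrightarrow> approximability \<S> A x \<rho> \<le> ennreal \<epsilon>"
      by (intro exI[of _ r]) (simp add: approximability_le_if_approx_in)
  qed
qed


section \<open>Detectability: closeness to the class propagates to small scales\<close>

lemma detectable_small: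
  assumes "detectable \<T> \<S>"
  obtains \<phi> where "\<phi> > 0"
    "\<And>\<eta>. \<eta> > 0 \<Longrightarrow> \<exists>s. 0 < s \<and> s < 1 \<and> (\<forall>S\<in>\<S>. \<forall>r>0. approximability \<T> S 0 r < ennreal \<phi> \<longrightarrow>
        approximability \<T> S 0 (s * r) < ennreal \<eta>)"
proof -
  obtain \<phi> :: real and \<Phi> :: "real \<Rightarrow> real" where \<Phi>: "\<phi> > 0"
    "Liminf (at_right 0) (\<lambda>s. ereal (\<Phi> s)) = 0"
    "\<And>S r s. \<lbrakk>S \<in> \<S>; r > 0; approximability \<T> S 0 r < ennreal \<phi>; s \<in> {0<..<1}\<rbrakk> \<Longrightarrow>
        approximability \<T> S 0 (s * r) < ennreal (\<Phi> s)"
    using assms unfolding detectable_def by blast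
  have *: "\<exists>s\<in>{0<..<1}. \<Phi> s < \<eta>" if "\<eta> > 0" for \<eta>
  proof (rule ccontr)
    assume "\<not> (\<exists>s\<in>{0<..<1}. \<Phi> s < \<eta>)"
    then have *: "\<And>s. 0 < s \<Longrightarrow> s < 1 \<Longrightarrow> ereal \<eta> \<le> ereal (\<Phi> s)" by force
    have "\<forall>\<^sub>F s in at_right 0. ereal \<eta> \<le> ereal (\<Phi> s)"
      unfolding eventually_at_right_field using * by (intro exI[of _ 1]) auto
    then have "ereal \<eta> \<le> Liminf (at_right 0) (\<lambda>s. ereal (\<Phi> s))" by (rule Liminf_bounded)
    with \<Phi>(2) that show False by simp
  qed
  then show ?thesis
  proof (intro that[of \<phi>] \<Phi>(1))
    fix \<eta> :: real assume "\<eta> > 0"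
    then obtain s where s: "s \<in> {0<..<1}" "\<Phi> s < \<eta>" using * by blast
    then have "ennreal (\<Phi> s) \<le> ennreal \<eta>" by (intro ennreal_leI) simp
    then have "\<forall>S\<in>\<S>. \<forall>r>0. approximability \<T> S 0 r < ennreal \<phi> \<longrightarrow>
        approximability \<T> S 0 (s * r) < ennreal \<eta>"
      using \<Phi>(3) s(1) by (meson less_le_trans)
    with s(1) show "\<exists>s. 0 < s \<and> s < 1 \<and> (\<forall>S\<in>\<S>. \<forall>r>0.
        approximability \<T> S 0 r < ennreal \<phi> \<longrightarrow> approximability \<T> S 0 (s * r) < ennreal \<eta>)"
      by auto
  qed
qed

text \<open>
  Detectability transferred from members of \<open>\<S>\<close> to sets close to them. The set \<open>B\<close> is replaced by
  a nearby member \<open>S\<close> of \<open>\<S>\<close>, whose closeness to \<open>\<T>\<close> improves at scale \<open>s * r / 2\<close>; returning to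
  \<open>B\<close> costs \<open>\<delta> * r\<close>, which is harmless at that scale if \<open>\<delta>\<close> is small compared with \<open>s\<close>.
\<close>

lemma detectable_step:
  assumes "detectable \<T> \<S>"
  obtains \<phi> where "0 < \<phi>" "\<phi> \<le> 1 / 4"
    "\<And>\<epsilon>. \<epsilon> > 0 \<Longrightarrow> \<exists>\<delta>>0. \<exists>t. 0 < t \<and> t < 1 \<and> (\<forall>B. \<forall>r>0.
       approx_in \<S> B r (\<delta> * r) \<longrightarrow> approx_in \<T> B r (\<phi> * r) \<longrightarrow> approx_in \<T> B (t * r) (\<epsilon> * (t * r)))"
proof -
  obtain \<phi>\<^sub>0 where \<phi>\<^sub>0: "\<phi>\<^sub>0 > 0"
    "\<And>\<eta>. \<eta> > 0 \<Longrightarrow> \<exists>s. 0 < s \<and> s < 1 \<and> (\<forall>S\<in>\<S>. \<forall>r>0. approximability \<T> S 0 r < ennreal \<phi>\<^sub>0 \<longrightarrow>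
        approximability \<T> S 0 (s * r) < ennreal \<eta>)"
    using detectable_small[OF assms] by blast
  \<comment> \<open>Going to half the radius doubles the relative error, and adding \<open>\<delta> \<le> \<phi>\<close> doubles it again;
      the result \<open>4 * \<phi>\<close> has to stay below the threshold \<open>\<phi>\<^sub>0\<close>.\<close>
  define \<phi> where "\<phi> = min (1 / 4) (\<phi>\<^sub>0 / 8)"
  have \<phi>: "0 < \<phi>" "\<phi> \<le> 1 / 4" "4 * \<phi> < \<phi>\<^sub>0" using \<phi>\<^sub>0(1) by (auto simp: \<phi>_def min_def)
  have "\<exists>\<delta>>0. \<exists>t. 0 < t \<and> t < 1 \<and> (\<forall>B. \<forall>r>0.
       approx_in \<S> B r (\<delta> * r) \<longrightarrow> approx_in \<T> B r (\<phi> * r) \<longrightarrow> approx_in \<T> B (t * r) (\<epsilon> * (t * r)))"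
    if "\<epsilon> > 0" for \<epsilon>
  proof -
    \<comment> \<open>The two errors \<open>\<eta> * (s * r / 2)\<close> and \<open>\<delta> * r\<close> each receive half of the target
      \<open>\<epsilon> * (s * r / 4)\<close>.\<close>
    define \<eta> where "\<eta> = min 1 (\<epsilon> / 4)"
    have \<eta>: "0 < \<eta>" "\<eta> \<le> 1" "\<eta> \<le> \<epsilon> / 4" using that by (auto simp: \<eta>_def)
    from \<phi>\<^sub>0(2)[OF \<eta>(1)] obtain s where s: "0 < s" "s < 1"
      "\<And>S r. \<lbrakk>S \<in> \<S>; r > 0; approximability \<T> S 0 r < ennreal \<phi>\<^sub>0\<rbrakk> \<Longrightarrow>
        approximability \<T> S 0 (s * r) < ennreal \<eta>" by blast
    define \<delta> where "\<delta> = min \<phi> (min (s / 4) (\<epsilon> * s / 8))"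
    have \<delta>: "0 < \<delta>" "\<delta> \<le> \<phi>" "\<delta> \<le> s / 4" "\<delta> \<le> \<epsilon> * s / 8"
      using \<phi> s that by (auto simp: \<delta>_def)
    have "approx_in \<T> B (s / 4 * r) (\<epsilon> * (s / 4 * r))"
      if r: "r > 0" and B: "approx_in \<S> B r (\<delta> * r)" "approx_in \<T> B r (\<phi> * r)" for B r
    proof -
      obtain S where S: "S \<in> \<S>" "near_in r (\<delta> * r) B S" using B(1) unfolding approx_in_def by blast
      have r1: "\<delta> * r \<le> r / 4" "\<phi> * r \<le> r / 4" "\<delta> * r \<le> \<phi> * r"
        using mult_right_mono[of \<delta> "1/4" r] mult_right_mono[of \<phi> "1/4" r] mult_right_mono[of \<delta> \<phi> r] r \<delta> \<phi>
        by auto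
      have "approx_in \<T> S (r / 2) (\<delta> * r + \<phi> * r)"
        by (rule approx_in_trans[OF near_in_sym[OF S(2)] B(2)]) (use r r1 in linarith)+
      then have "approx_in \<T> S (r / 2) (4 * \<phi> * (r / 2))"
        by (rule approx_in_mono) (use r1 in auto)
      then have "approximability \<T> S 0 (r / 2) \<le> ennreal (4 * \<phi>)"
        using r approximability_le_if_approx_in[of \<T> S 0] by simp
      also have "\<dots> < ennreal \<phi>\<^sub>0" using \<phi> by (intro ennreal_lessI) auto
      finally have "approximability \<T> S 0 (s * (r / 2)) < ennreal \<eta>"
        by (intro s(3) S(1)) (use r in simp)
      then have T: "approx_in \<T> S (s * (r / 2)) (\<eta> * (s * (r / 2)))"
        using approx_in_if_approximability_less[of \<T> S 0 "s * (r / 2)" \<eta>] s(1) r by simp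
      define q where "q = s * r"
      have q: "0 < q" "q \<le> r" "\<delta> * r \<le> q / 4" "\<delta> * r \<le> \<epsilon> * q / 8" "\<eta> * q \<le> q" "\<eta> * q \<le> \<epsilon> * q / 4"
        using mult_right_mono[of s 1 r] mult_right_mono[OF \<delta>(3), of r] mult_right_mono[OF \<delta>(4), of r]
          mult_right_mono[OF \<eta>(2), of q] mult_right_mono[OF \<eta>(3), of q] s r
        by (auto simp: algebra_simps q_def)
      have "approx_in \<T> S (q / 2) (\<eta> * (q / 2))" using T by (simp add: q_def)
      then have "approx_in \<T> B (q / 4) (\<delta> * r + \<eta> * (q / 2))"
        by (rule approx_in_trans[OF S(2)]) (use q in linarith)+
      then have "approx_in \<T> B (q / 4) (\<epsilon> * (q / 4))"
        by (rule approx_in_mono) (use q in linarith)+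
      then show ?thesis by (simp add: q_def)
    qed
    moreover have "0 < s / 4" "s / 4 < 1" using s by auto
    ultimately show ?thesis using \<delta>(1) by blast
  qed
  with that \<phi> show ?thesis by blast
qed

lemma geometric_scale_cover:
  fixes t b \<rho> :: real
  assumes "0 < t" "t < 1" "0 < \<rho>" "\<rho> \<le> b"
  obtains k where "t ^ Suc k * b < \<rho>" "\<rho> \<le> t ^ k * b"
proof -
  have b: "0 < b" using assms by simp
  obtain m where "t ^ m < \<rho> / b"
    using real_arch_pow_inv[of "\<rho> / b" t] assms b by auto
  then have ex: "\<exists>m. t ^ m * b < \<rho>" using b by (auto simp: field_simps)
  define m where "m = (LEAST m. t ^ m * b < \<rho>)"
  have m: "t ^ m * b < \<rho>" unfolding m_def using ex by (rule LeastI_ex)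
  then have "m \<noteq> 0" using assms by (cases m) auto
  then obtain k where k: "m = Suc k" by (cases m) auto
  have "\<not> t ^ k * b < \<rho>"
    using not_less_Least[of k "\<lambda>m. t ^ m * b < \<rho>"] k unfolding m_def by simp
  with m k that show ?thesis by simp
qed

text \<open>
  The step is repeated with target \<open>\<phi>\<close>, and once more with a fine target. The resulting rate
  depends, for given classes, only on \<open>r\<close> and on the rate of approximation by \<open>\<S>\<close>, so it is common
  to all base points in \<open>Y\<close>. The scale \<open>r\<close> only has to be small enough for the fixed accuracy \<open>\<delta>\<^sub>0\<close>.
\<close>

lemma detectable_propagation:
  assumes "detectable \<T> \<S>"
  obtains \<phi> \<delta>\<^sub>0 where "0 < \<phi>" "\<phi> \<le> 1 / 4" "0 < \<delta>\<^sub>0"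
    "\<And>A Y r. \<lbrakk>uniformly_approximated \<S> A Y; r > 0;
       \<And>x \<rho>. \<lbrakk>x \<in> Y; 0 < \<rho>; \<rho> \<le> r\<rbrakk> \<Longrightarrow> approx_in \<S> (recenter A x) \<rho> (\<delta>\<^sub>0 * \<rho>);
       \<And>x. x \<in> Y \<Longrightarrow> approx_in \<T> (recenter A x) r (\<phi> * r)\<rbrakk> \<Longrightarrow> uniformly_approximated \<T> A Y"
proof -
  obtain \<phi> where \<phi>: "0 < \<phi>" "\<phi> \<le> 1 / 4"
    and step: "\<And>\<epsilon>. \<epsilon> > 0 \<Longrightarrow> \<exists>\<delta>>0. \<exists>t. 0 < t \<and> t < 1 \<and> (\<forall>B. \<forall>r>0.
       approx_in \<S> B r (\<delta> * r) \<longrightarrow> approx_in \<T> B r (\<phi> * r) \<longrightarrow> approx_in \<T> B (t * r) (\<epsilon> * (t * r)))"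
    using detectable_step[OF assms] by blast
  from step[OF \<phi>(1)] obtain \<delta>\<^sub>0 t\<^sub>0 where \<delta>\<^sub>0: "\<delta>\<^sub>0 > 0" and t\<^sub>0: "0 < t\<^sub>0" "t\<^sub>0 < 1"
    and step0: "\<And>B r. \<lbrakk>r > 0; approx_in \<S> B r (\<delta>\<^sub>0 * r); approx_in \<T> B r (\<phi> * r)\<rbrakk> \<Longrightarrow>
       approx_in \<T> B (t\<^sub>0 * r) (\<phi> * (t\<^sub>0 * r))" by blast
  have "uniformly_approximated \<T> A Y"
    if A: "uniformly_approximated \<S> A Y" and r: "r > 0"
      and S: "\<And>x \<rho>. \<lbrakk>x \<in> Y; 0 < \<rho>; \<rho> \<le> r\<rbrakk> \<Longrightarrow> approx_in \<S> (recenter A x) \<rho> (\<delta>\<^sub>0 * \<rho>)"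
      and T: "\<And>x. x \<in> Y \<Longrightarrow> approx_in \<T> (recenter A x) r (\<phi> * r)" for A Y r
    unfolding uniformly_approximated_def
  proof (intro allI impI)
    fix \<epsilon> :: real assume \<epsilon>: "\<epsilon> > 0"
    have below: "0 < t\<^sub>0 ^ k * r" "t\<^sub>0 ^ k * r \<le> r" for k
      using t\<^sub>0 r power_le_one[of t\<^sub>0 k] mult_right_mono[of "t\<^sub>0 ^ k" 1 r] by auto
    have iter: "approx_in \<T> (recenter A x) (t\<^sub>0 ^ k * r) (\<phi> * (t\<^sub>0 ^ k * r))" if "x \<in> Y" for x k
    proof (induction k)
      case 0
      show ?case using T[OF that] by simp
    next
      case (Suc k)
      show ?case using step0[OF below(1) S[OF that below] Suc.IH] by (simp add: mult.assoc)
    qed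
    \<comment> \<open>A scale between two consecutive reached scales loses at most a factor \<open>1 / t\<^sub>0\<close> in relative
      error, so the last step aims at \<open>\<epsilon> * t\<^sub>0\<close>.\<close>
    have "\<epsilon> * t\<^sub>0 > 0" using \<epsilon> t\<^sub>0 by simp
    from step[OF this] obtain \<delta>\<^sub>1 t\<^sub>1 where \<delta>\<^sub>1: "\<delta>\<^sub>1 > 0" and t\<^sub>1: "0 < t\<^sub>1" "t\<^sub>1 < 1"
      and step1: "\<And>B r. \<lbrakk>r > 0; approx_in \<S> B r (\<delta>\<^sub>1 * r); approx_in \<T> B r (\<phi> * r)\<rbrakk> \<Longrightarrow>
         approx_in \<T> B (t\<^sub>1 * r) (\<epsilon> * t\<^sub>0 * (t\<^sub>1 * r))" by blast
    obtain R where R: "R > 0"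
      "\<And>x \<rho>. \<lbrakk>x \<in> Y; 0 < \<rho>; \<rho> \<le> R\<rbrakk> \<Longrightarrow> approx_in \<S> (recenter A x) \<rho> (\<delta>\<^sub>1 * \<rho>)"
      using uniformly_approximatedD[OF A \<delta>\<^sub>1] by blast
    \<comment> \<open>The fine step is available only below \<open>R\<close>, where \<open>\<S>\<close> approximates with accuracy \<open>\<delta>\<^sub>1\<close>;
      iterating the coarse step \<open>m\<close> times reaches that range.\<close>
    obtain m where m: "t\<^sub>0 ^ m * r \<le> R"
    proof -
      obtain m where "t\<^sub>0 ^ m < R / r" using real_arch_pow_inv[of "R / r" t\<^sub>0] t\<^sub>0 r R(1) by auto
      with r that[of m] show ?thesis by (simp add: field_simps)
    qed
    define b where "b = t\<^sub>1 * (t\<^sub>0 ^ m * r)"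
    have b: "b > 0" using t\<^sub>1 below by (simp add: b_def)
    show "\<exists>r>0. \<forall>x\<in>Y. \<forall>\<rho>. 0 < \<rho> \<and> \<rho> \<le> r \<longrightarrow> approx_in \<T> (recenter A x) \<rho> (\<epsilon> * \<rho>)"
    proof (intro exI[of _ b] conjI ballI allI impI b)
      fix x \<rho> assume x: "x \<in> Y" and \<rho>: "0 < \<rho> \<and> \<rho> \<le> b"
      obtain k where k: "t\<^sub>0 ^ Suc k * b < \<rho>" "\<rho> \<le> t\<^sub>0 ^ k * b"
        using geometric_scale_cover[OF t\<^sub>0, of \<rho> b] \<rho> by blast
      let ?q = "t\<^sub>0 ^ (k + m) * r"
      have "t\<^sub>0 ^ k * (t\<^sub>0 ^ m * r) \<le> 1 * (t\<^sub>0 ^ m * r)"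
        using below(1)[of m] power_le_one[of t\<^sub>0 k] t\<^sub>0 by (intro mult_right_mono) auto
      then have "?q \<le> R" using m by (simp add: power_add mult.assoc)
      then have "approx_in \<T> (recenter A x) (t\<^sub>1 * ?q) (\<epsilon> * t\<^sub>0 * (t\<^sub>1 * ?q))"
        by (intro step1 below R(2) x iter)
      moreover have q: "t\<^sub>1 * ?q = t\<^sub>0 ^ k * b" by (simp add: b_def power_add mult_ac)
      moreover have "\<epsilon> * t\<^sub>0 * (t\<^sub>0 ^ k * b) \<le> \<epsilon> * \<rho>"
        using mult_left_mono[of "t\<^sub>0 ^ Suc k * b" \<rho> \<epsilon>] k(1) \<epsilon> by (simp add: mult.assoc)
      ultimately show "approx_in \<T> (recenter A x) \<rho> (\<epsilon> * \<rho>)"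
        using k(2) approx_in_mono by metis
    qed
  qed
  with \<phi> \<delta>\<^sub>0 show ?thesis using that by blast
qed


section \<open>Points at which the set is asymptotically in the class\<close>

lemma LIMSEQ_if_dist_le:
  assumes "\<And>i. dist (f i) l \<le> g i" "g \<longlonglongrightarrow> (0::real)"
  shows "f \<longlonglongrightarrow> l"
proof (rule iffD2[OF tendsto_dist_iff])
  show "(\<lambda>i. dist (f i) l) \<longlonglongrightarrow> 0"
    by (rule tendsto_sandwich[OF _ _ tendsto_const assms(2)]) (simp_all add: assms(1))
qed

text \<open>
  The sequence with its limit is compact, so the approximation by \<open>\<S>\<close> is uniform along it, and
  closeness to \<open>\<T>\<close> at one fixed scale carries over from \<open>x\<close> to all nearby terms;
  propagation does the rest.
\<close>

lemma uniformly_approximated_tail: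
  assumes "detectable \<T> \<S>" and A: "locally_well_approximated A \<S>"
    and x: "x \<in> A" "uniformly_approximated \<T> A {x}"
    and y: "\<And>i. y i \<in> A" "y \<longlonglongrightarrow> x"
  shows "\<exists>N. uniformly_approximated \<T> A (y ` {N..})"
proof -
  obtain \<phi> \<delta>\<^sub>0 where \<phi>: "0 < \<phi>" "\<phi> \<le> 1 / 4" and "0 < \<delta>\<^sub>0"
    and propagate: "\<And>A Y r. \<lbrakk>uniformly_approximated \<S> A Y; r > 0;
       \<And>x \<rho>. \<lbrakk>x \<in> Y; 0 < \<rho>; \<rho> \<le> r\<rbrakk> \<Longrightarrow> approx_in \<S> (recenter A x) \<rho> (\<delta>\<^sub>0 * \<rho>);
       \<And>x. x \<in> Y \<Longrightarrow> approx_in \<T> (recenter A x) r (\<phi> * r)\<rbrakk> \<Longrightarrow> uniformly_approximated \<T> A Y"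
    using detectable_propagation[OF assms(1)] by blast
  have "compact (insert x (range y))" by (rule compact_sequence_with_limit[OF y(2)])
  moreover have "insert x (range y) \<subseteq> A" using x(1) y(1) by auto
  ultimately have K: "uniformly_approximated \<S> A (insert x (range y))"
    using A unfolding locally_well_approximated_iff by simp
  obtain r\<^sub>0 where r\<^sub>0: "r\<^sub>0 > 0"
    "\<And>z \<rho>. \<lbrakk>z \<in> insert x (range y); 0 < \<rho>; \<rho> \<le> r\<^sub>0\<rbrakk> \<Longrightarrow> approx_in \<S> (recenter A z) \<rho> (\<delta>\<^sub>0 * \<rho>)"
    using uniformly_approximatedD[OF K \<open>0 < \<delta>\<^sub>0\<close>] by blast
  have "\<phi> / 4 > 0" using \<phi> by simp
  obtain r\<^sub>1 where r\<^sub>1: "r\<^sub>1 > 0"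
    "\<And>\<rho>. \<lbrakk>0 < \<rho>; \<rho> \<le> r\<^sub>1\<rbrakk> \<Longrightarrow> approx_in \<T> (recenter A x) \<rho> (\<phi> / 4 * \<rho>)"
    using uniformly_approximated_singletonD[OF x(2) \<open>\<phi> / 4 > 0\<close>] by metis
  define r where "r = min r\<^sub>0 r\<^sub>1"
  have r: "0 < r" "r \<le> r\<^sub>0" "r \<le> r\<^sub>1" using r\<^sub>0(1) r\<^sub>1(1) by (auto simp: r_def)
  \<comment> \<open>Half of the allowed error \<open>\<phi> * (r / 2)\<close> pays for moving the base point, the other half for the
      approximation at \<open>x\<close>.\<close>
  define d where "d = \<phi> / 4 * r"
  have d: "0 < d" "d \<le> r / 4" using \<phi> r mult_right_mono[of "\<phi> / 4" "1 / 4" r] by (auto simp: d_def)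
  obtain N where N: "\<And>i. i \<ge> N \<Longrightarrow> dist (y i) x < d"
    using LIMSEQ_D[OF y(2) d(1)] by (auto simp: dist_norm)
  have "uniformly_approximated \<T> A (y ` {N..})"
  proof (rule propagate)
    show "uniformly_approximated \<S> A (y ` {N..})"
      by (rule uniformly_approximated_subset[OF K]) auto
    show "r / 2 > 0" using r by simp
    show "approx_in \<S> (recenter A z) \<rho> (\<delta>\<^sub>0 * \<rho>)" if "z \<in> y ` {N..}" "0 < \<rho>" "\<rho> \<le> r / 2" for z \<rho>
      using that r by (intro r\<^sub>0(2)) auto
    show "approx_in \<T> (recenter A z) (r / 2) (\<phi> * (r / 2))" if z: "z \<in> y ` {N..}" for z
    proof -
      have "dist z x < d" using z N by auto
      then have "near_in r d (recenter A z) (recenter A x)"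
        by (intro near_in_recenter_dense closure_subset order_refl)
      moreover have "approx_in \<T> (recenter A x) r d" unfolding d_def using r by (intro r\<^sub>1(2))
      ultimately have "approx_in \<T> (recenter A z) (r / 2) (d + d)"
        by (rule approx_in_trans) (use d r in auto)
      moreover have "d + d = \<phi> * (r / 2)" by (simp add: d_def)
      ultimately show ?thesis by simp
    qed
  qed
  then show ?thesis by blast
qed

definition regular_part :: "'a::euclidean_space set set \<Rightarrow> 'a set \<Rightarrow> 'a set" where
  "regular_part \<T> A = {x \<in> A. uniformly_approximated \<T> A {x}}"

lemma openin_regular_part:
  assumes "detectable \<T> \<S>" "locally_well_approximated A \<S>"
  shows "openin (top_of_set A) (regular_part \<T> A)"
  unfolding openin_euclidean_subtopology_iff
proof (intro conjI ballI)
  show "regular_part \<T> A \<subseteq> A" by (auto simp: regular_part_def)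
  fix x assume x: "x \<in> regular_part \<T> A"
  show "\<exists>e>0. \<forall>x'\<in>A. dist x' x < e \<longrightarrow> x' \<in> regular_part \<T> A"
  proof (rule ccontr)
    assume "\<not> (\<exists>e>0. \<forall>x'\<in>A. dist x' x < e \<longrightarrow> x' \<in> regular_part \<T> A)"
    then have "\<forall>i. \<exists>z\<in>A. dist z x < inverse (Suc i) \<and> z \<notin> regular_part \<T> A"
      by (metis inverse_positive_iff_positive of_nat_0_less_iff zero_less_Suc)
    then obtain y where y: "\<And>i. y i \<in> A" "\<And>i. dist (y i) x < inverse (Suc i)"
      "\<And>i. y i \<notin> regular_part \<T> A" by metis
    have "y \<longlonglongrightarrow> x"
      by (rule LIMSEQ_if_dist_le[OF less_imp_le[OF y(2)] LIMSEQ_inverse_real_of_nat])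
    moreover have "x \<in> A" "uniformly_approximated \<T> A {x}"
      using x by (simp_all add: regular_part_def)
    ultimately obtain N where "uniformly_approximated \<T> A (y ` {N..})"
      using uniformly_approximated_tail[OF assms] y(1) by metis
    then have "uniformly_approximated \<T> A {y N}"
      by (rule uniformly_approximated_subset) auto
    with y(1,3) show False by (auto simp: regular_part_def)
  qed
qed

text \<open>
  If uniformity failed, the bad base points would accumulate at some point of \<open>K\<close>, contradicting
  the common rate along a sequence converging to it.
\<close>

lemma uniformly_approximated_compact:
  assumes "detectable \<T> \<S>" "locally_well_approximated A \<S>"
    and K: "compact K" "K \<subseteq> regular_part \<T> A"
  shows "uniformly_approximated \<T> A K"
proof (rule ccontr)
  assume "\<not> uniformly_approximated \<T> A K"
  then obtain \<epsilon> where \<epsilon>: "\<epsilon> > 0"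
    "\<And>r. r > 0 \<Longrightarrow> \<exists>z\<in>K. \<exists>\<rho>. 0 < \<rho> \<and> \<rho> \<le> r \<and> \<not> approx_in \<T> (recenter A z) \<rho> (\<epsilon> * \<rho>)"
    unfolding uniformly_approximated_def by meson
  have "\<forall>i. \<exists>z \<rho>. z \<in> K \<and> 0 < \<rho> \<and> \<rho> \<le> inverse (Suc i) \<and> \<not> approx_in \<T> (recenter A z) \<rho> (\<epsilon> * \<rho>)"
    using \<epsilon>(2) by (metis inverse_positive_iff_positive of_nat_0_less_iff zero_less_Suc)
  then obtain z \<rho> where z: "\<And>i. z i \<in> K" "\<And>i. 0 < \<rho> i" "\<And>i. \<rho> i \<le> inverse (Suc i)"
    "\<And>i. \<not> approx_in \<T> (recenter A (z i)) (\<rho> i) (\<epsilon> * \<rho> i)" by metis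
  obtain x f where x: "x \<in> K" and f: "strict_mono f" "(z \<circ> f) \<longlonglongrightarrow> x"
    using K(1)[unfolded compact_def] z(1) by metis
  have "x \<in> A" "uniformly_approximated \<T> A {x}" "\<And>i. (z \<circ> f) i \<in> A"
    using x z(1) K(2) by (auto simp: regular_part_def)
  from uniformly_approximated_tail[OF assms(1,2) this f(2)]
  obtain N where "uniformly_approximated \<T> A ((z \<circ> f) ` {N..})" by blast
  from uniformly_approximatedD[OF this \<epsilon>(1)] obtain r where r: "r > 0"
    "\<And>w \<sigma>. \<lbrakk>w \<in> (z \<circ> f) ` {N..}; 0 < \<sigma>; \<sigma> \<le> r\<rbrakk> \<Longrightarrow> approx_in \<T> (recenter A w) \<sigma> (\<epsilon> * \<sigma>)"
    by blast
  obtain M where M: "inverse (Suc M) < r" using reals_Archimedean[OF r(1)] by blast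
  define i where "i = max N M"
  have "M \<le> f i" using seq_suble[OF f(1), of i] by (simp add: i_def)
  then have "inverse (real (Suc (f i))) \<le> inverse (real (Suc M))" by (intro le_imp_inverse_le) auto
  then have "\<rho> (f i) \<le> r" using z(3)[of "f i"] M by linarith
  moreover have "z (f i) \<in> (z \<circ> f) ` {N..}" by (auto simp: i_def)
  ultimately have "approx_in \<T> (recenter A (z (f i))) (\<rho> (f i)) (\<epsilon> * \<rho> (f i))"
    using z(2) by (intro r(2))
  with z(4) show False by blast
qed

text \<open>
  Approximation of \<open>A\<close> at points of \<open>V\<close> has to be turned into approximation of \<open>V\<close> itself. Around
  a compact subset of \<open>V\<close> the two sets agree in balls of a fixed radius.
\<close>

lemma locally_well_approximated_relatively_open:
  assumes "openin (top_of_set A) V"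
    and K: "\<And>K. \<lbrakk>compact K; K \<subseteq> V\<rbrakk> \<Longrightarrow> uniformly_approximated \<T> A K"
  shows "locally_well_approximated V \<T>"
  unfolding locally_well_approximated_iff
proof (intro allI impI)
  fix K assume "compact K \<and> K \<subseteq> V"
  then have K': "compact K" "K \<subseteq> V" by auto
  obtain U where U: "open U" "V = A \<inter> U" using assms(1) by (auto simp: openin_open)
  obtain d where d: "d > 0" "\<And>x z. \<lbrakk>x \<in> K; dist x z < d\<rbrakk> \<Longrightarrow> z \<in> U"
  proof -
    obtain d where "d > 0" "(\<Union>x\<in>K. ball x d) \<subseteq> U"
      using compact_subset_open_imp_ball_epsilon_subset[OF K'(1) U(1)] K'(2) U(2) by auto
    with that[of d] show ?thesis by (force simp: subset_iff)
  qed
  show "uniformly_approximated \<T> V K"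
    unfolding uniformly_approximated_def
  proof (intro allI impI)
    fix \<epsilon> :: real assume "\<epsilon> > 0"
    \<comment> \<open>With relative error at most 1, the witness in \<open>A\<close> for a point of the \<open>\<rho>\<close>-ball lies in the
      ball of radius \<open>2 * \<rho>\<close>, where \<open>A\<close> and \<open>V\<close> agree.\<close>
    define \<epsilon>' where "\<epsilon>' = min 1 \<epsilon>"
    have \<epsilon>': "0 < \<epsilon>'" "\<epsilon>' \<le> 1" "\<epsilon>' \<le> \<epsilon>" using \<open>\<epsilon> > 0\<close> by (auto simp: \<epsilon>'_def)
    obtain r where r: "r > 0"
      "\<And>x \<rho>. \<lbrakk>x \<in> K; 0 < \<rho>; \<rho> \<le> r\<rbrakk> \<Longrightarrow> approx_in \<T> (recenter A x) \<rho> (\<epsilon>' * \<rho>)"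
      using uniformly_approximatedD[OF K[OF K'] \<epsilon>'(1)] by blast
    define r' where "r' = min r (d / 4)"
    have r': "r' > 0" "r' \<le> r" "r' \<le> d / 4" using r(1) d(1) by (auto simp: r'_def)
    show "\<exists>r>0. \<forall>x\<in>K. \<forall>\<rho>. 0 < \<rho> \<and> \<rho> \<le> r \<longrightarrow> approx_in \<T> (recenter V x) \<rho> (\<epsilon> * \<rho>)"
    proof (intro exI[of _ r'] conjI ballI allI impI r'(1))
      fix x \<rho> assume x: "x \<in> K" and \<rho>: "0 < \<rho> \<and> \<rho> \<le> r'"
      have in_V: "u \<in> recenter V x" if u: "u \<in> recenter A x" "norm u \<le> 2 * \<rho>" for u
      proof -
        obtain a where a: "a \<in> A" "u = a - x" using u(1) by (auto simp: recenter_def)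
        then have "dist x a < d" using u(2) \<rho> r' d(1) by (simp add: dist_norm norm_minus_commute)
        with a d(2)[OF x] U(2) show ?thesis by (auto simp: recenter_def)
      qed
      obtain S where S: "S \<in> \<T>" "near_in \<rho> (\<epsilon>' * \<rho>) (recenter A x) S"
        using r(2)[OF x] \<rho> r' unfolding approx_in_def by force
      have "near_in \<rho> (\<epsilon>' * \<rho>) (recenter V x) S"
        unfolding near_in_def
      proof (intro conjI ballI impI)
        fix a assume "a \<in> recenter V x" "norm a \<le> \<rho>"
        moreover then have "a \<in> recenter A x" using U(2) by (auto simp: recenter_def)
        ultimately show "\<exists>b\<in>S. dist a b < \<epsilon>' * \<rho>" using S(2) by (simp add: near_in_def)
      next
        fix b assume b: "b \<in> S" "norm b \<le> \<rho>"
        then obtain a where a: "a \<in> recenter A x" "dist b a < \<epsilon>' * \<rho>"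
          using S(2) unfolding near_in_def by blast
        have "\<epsilon>' * \<rho> \<le> \<rho>" using \<epsilon>' \<rho> mult_right_mono[of \<epsilon>' 1 \<rho>] by simp
        moreover have "norm a \<le> norm b + dist b a" by norm
        ultimately have "norm a \<le> 2 * \<rho>" using a b by linarith
        with a in_V show "\<exists>a\<in>recenter V x. dist b a < \<epsilon>' * \<rho>" by blast
      qed
      then have "near_in \<rho> (\<epsilon> * \<rho>) (recenter V x) S"
        by (rule near_in_mono) (use \<epsilon>' \<rho> in \<open>auto intro: mult_right_mono\<close>)
      with S(1) show "approx_in \<T> (recenter V x) \<rho> (\<epsilon> * \<rho>)" unfolding approx_in_def by blast
    qed
  qed
qed


section \<open>Tangent and pseudotangent sets\<close>

lemma blowup_eq_scaleR_recenter: "(\<lambda>a. (a - x) /\<^sub>R r) ` A = (*\<^sub>R) (inverse r) ` recenter A x"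
  by (simp add: recenter_def image_image)

text \<open>
  Base points may be moved by an amount negligible against the scale, and the closure replaced by
  the set, without affecting the limit of the blow-ups. So pseudotangent sets of \<open>closure A\<close> can be
  studied from base points in \<open>A\<close>, the only points where the hypotheses say anything.
\<close>

lemma eventually_near_in_blowup:
  fixes r :: "nat \<Rightarrow> real"
  assumes conv: "aw_converges (\<lambda>i. (\<lambda>a. (a - y i) /\<^sub>R r i) ` closure A) T"
    and r: "\<And>i. r i > 0" and z: "\<And>i. dist (z i) (y i) < r i * inverse (Suc i)"
    and "\<eta> > 0"
  shows "\<forall>\<^sub>F i in sequentially. near_in R \<eta> T ((*\<^sub>R) (inverse (r i)) ` recenter A (z i))"
proof -
  define R' where "R' = max 1 R + \<eta>"
  have R': "R' > 0" "R + \<eta> \<le> R'" using \<open>\<eta> > 0\<close> by (auto simp: R'_def)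
  have "\<forall>\<^sub>F i in sequentially. aw_near R' (\<eta> / 2) T ((\<lambda>a. (a - y i) /\<^sub>R r i) ` closure A)"
    using conv R'(1) \<open>\<eta> > 0\<close> unfolding aw_converges_iff_near by simp
  moreover have "\<forall>\<^sub>F i in sequentially. inverse (real (Suc i)) < \<eta> / 2"
    using \<open>\<eta> > 0\<close> by (intro order_tendstoD(2)[OF LIMSEQ_inverse_real_of_nat]) simp
  ultimately show ?thesis
  proof eventually_elim
    case (elim i)
    let ?c = "inverse (r i)"
    have "near_in R' (\<eta> / 2) T ((*\<^sub>R) ?c ` recenter (closure A) (y i))"
      using near_in_if_aw_near[OF elim(1)] by (simp add: blowup_eq_scaleR_recenter)
    moreover have "near_in R' (\<eta> / 2) ((*\<^sub>R) ?c ` recenter (closure A) (y i)) ((*\<^sub>R) ?c ` recenter A (z i))"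
    proof (rule near_in_sym)
      have "r i * inverse (Suc i) < r i * (\<eta> / 2)" using elim(2) r by (intro mult_strict_left_mono)
      with z[of i] have "dist (z i) (y i) < r i * (\<eta> / 2)" by linarith
      then have "near_in (r i * R') (r i * (\<eta> / 2)) (recenter A (z i)) (recenter (closure A) (y i))"
        by (intro near_in_recenter_dense closure_subset order_refl)
      from near_in_scaleR[OF this, of ?c] r[of i]
      show "near_in R' (\<eta> / 2) ((*\<^sub>R) ?c ` recenter A (z i)) ((*\<^sub>R) ?c ` recenter (closure A) (y i))"
        by (simp add: field_simps)
    qed
    ultimately have "near_in R (\<eta> / 2 + \<eta> / 2) T ((*\<^sub>R) ?c ` recenter A (z i))"
      by (rule near_in_trans) (use R' \<open>\<eta> > 0\<close> in auto)
    then show ?case by simp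
  qed
qed

lemma pseudotangent_base_points_in_set:
  assumes "T \<in> pseudotangent_sets (closure A) x"
  shows "\<exists>z r. (\<forall>i. z i \<in> A) \<and> z \<longlonglongrightarrow> x \<and> (\<forall>i. r i > 0) \<and> r \<longlonglongrightarrow> (0::real) \<and>
    (\<forall>R. \<forall>\<eta>>0. \<forall>\<^sub>F i in sequentially.
       near_in R \<eta> T ((*\<^sub>R) (inverse (r i)) ` recenter A (z i)))"
proof -
  obtain y r where y: "\<And>i. y i \<in> closure A" "y \<longlonglongrightarrow> x" and r: "\<And>i. r i > 0" "r \<longlonglongrightarrow> (0::real)"
    and conv: "aw_converges (\<lambda>i. (\<lambda>a. (a - y i) /\<^sub>R r i) ` closure A) T"
    using assms unfolding pseudotangent_sets_def by blast
  have "\<exists>a\<in>A. dist a (y i) < r i * inverse (Suc i)" for i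
    using y(1)[of i] r(1)[of i] unfolding closure_approachable by simp
  then obtain z where z: "\<And>i. z i \<in> A" "\<And>i. dist (z i) (y i) < r i * inverse (Suc i)" by metis
  have "(\<lambda>i. r i * inverse (real (Suc i))) \<longlonglongrightarrow> 0 * 0"
    by (intro tendsto_mult r(2) LIMSEQ_inverse_real_of_nat)
  moreover have "(\<lambda>i. dist (y i) x) \<longlonglongrightarrow> 0" by (rule iffD1[OF tendsto_dist_iff y(2)])
  ultimately have "(\<lambda>i. r i * inverse (real (Suc i)) + dist (y i) x) \<longlonglongrightarrow> 0 * 0 + 0"
    by (rule tendsto_add)
  then have to_0: "(\<lambda>i. r i * inverse (real (Suc i)) + dist (y i) x) \<longlonglongrightarrow> 0"
    by (simp only: mult_zero_left add_0)
  have "dist (z i) x \<le> r i * inverse (real (Suc i)) + dist (y i) x" for i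
    using z(2)[of i] dist_triangle[of "z i" x "y i"] by linarith
  then have "z \<longlonglongrightarrow> x" by (rule LIMSEQ_if_dist_le[OF _ to_0])
  show ?thesis
    by (intro exI[of _ z] exI[of _ r] conjI allI impI z(1) \<open>z \<longlonglongrightarrow> x\<close> r
        eventually_near_in_blowup[OF conv r(1) z(2)])
qed

lemma blowup_limit_in_aw_closure:
  assumes \<T>: "local_approximation_class \<T>" and T: "T \<in> closed_sets0"
    and r: "\<And>i. r i > 0" "r \<longlonglongrightarrow> (0::real)"
    and lim: "\<And>R \<eta>. \<eta> > 0 \<Longrightarrow>
       \<forall>\<^sub>F i in sequentially. near_in R \<eta> T ((*\<^sub>R) (inverse (r i)) ` recenter A (z i))"
    and UA: "uniformly_approximated \<T> A (z ` {N..})"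
  shows "T \<in> aw_closure \<T>"
proof -
  have near: "\<exists>S\<in>\<T>. aw_near R \<eta> T S" if "R > 0" "\<eta> > 0" for R \<eta> :: real
  proof -
    define R' where "R' = R + \<eta>"
    have R': "R' > 0" using that by (simp add: R'_def)
    define \<epsilon> where "\<epsilon> = \<eta> / 4 / R'"
    have \<epsilon>: "\<epsilon> > 0" "\<epsilon> * R' = \<eta> / 4" using that R' by (auto simp: \<epsilon>_def)
    obtain s where s: "s > 0"
      "\<And>w \<rho>. \<lbrakk>w \<in> z ` {N..}; 0 < \<rho>; \<rho> \<le> s\<rbrakk> \<Longrightarrow> approx_in \<T> (recenter A w) \<rho> (\<epsilon> * \<rho>)"
      using uniformly_approximatedD[OF UA \<epsilon>(1)] by blast
    have "\<forall>\<^sub>F i in sequentially. r i < s / R'"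
      using s(1) R' by (intro order_tendstoD(2)[OF r(2)]) simp
    moreover have "\<forall>\<^sub>F i in sequentially. near_in R' (\<eta> / 4) T ((*\<^sub>R) (inverse (r i)) ` recenter A (z i))"
      using that by (intro lim) simp
    moreover note eventually_ge_at_top[of N]
    ultimately have "\<forall>\<^sub>F i in sequentially. r i < s / R' \<and>
        near_in R' (\<eta> / 4) T ((*\<^sub>R) (inverse (r i)) ` recenter A (z i)) \<and> N \<le> i"
      by eventually_elim blast
    then obtain i where i: "r i < s / R'" "N \<le> i"
      "near_in R' (\<eta> / 4) T ((*\<^sub>R) (inverse (r i)) ` recenter A (z i))"
      using eventually_happens'[OF sequentially_bot] by force
    have "approx_in \<T> (recenter A (z i)) (r i * R') (\<epsilon> * (r i * R'))"
    proof (rule s(2))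
      show "z i \<in> z ` {N..}" using i(2) by simp
      show "0 < r i * R'" using r(1) R' by simp
      show "r i * R' \<le> s" using i(1) R' by (simp add: pos_less_divide_eq)
    qed
    from approx_in_scaleR[OF \<T> _ this, of "inverse (r i)"] r(1)[of i]
    have "approx_in \<T> ((*\<^sub>R) (inverse (r i)) ` recenter A (z i))
        (inverse (r i) * (r i * R')) (inverse (r i) * (\<epsilon> * (r i * R')))"
      by simp
    moreover have "inverse (r i) * (r i * R') = R'" "inverse (r i) * (\<epsilon> * (r i * R')) = \<epsilon> * R'"
      using r(1)[of i] by simp_all
    ultimately have "approx_in \<T> ((*\<^sub>R) (inverse (r i)) ` recenter A (z i)) R' (\<eta> / 4)"
      by (simp only: \<epsilon>(2))
    from i(3) this have "approx_in \<T> T R (\<eta> / 4 + \<eta> / 4)"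
      by (rule approx_in_trans) (use that in \<open>auto simp: R'_def\<close>)
    then obtain S where "S \<in> \<T>" "near_in R (\<eta> / 4 + \<eta> / 4) T S" unfolding approx_in_def by blast
    moreover from this(2) have "aw_near R \<eta> T S"
      by (rule aw_near_if_near_in) (use that in simp_all)
    ultimately show ?thesis by blast
  qed
  have "\<exists>S\<in>\<T>. aw_near (Suc n) (1 / Suc n) T S" for n by (rule near) auto
  then obtain X where X: "\<forall>n. X n \<in> \<T>" "\<forall>n. aw_near (Suc n) (1 / Suc n) T (X n)" by metis
  then have "aw_converges X T" by (intro aw_converges_if_near_Suc) simp
  moreover have "\<T> \<subseteq> closed_sets0" using \<T> by (simp add: local_approximation_class_def)
  ultimately show ?thesis using X(1) T by (simp add: in_aw_closure_iff) blast
qed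

text \<open>
  The hypothesis on sequences holds for \<open>\<S>\<close> at every point of \<open>A\<close> and for \<open>\<T>\<close> at every point of
  the regular part, so that this lemma serves both classes.
\<close>

lemma pseudotangent_sets_subset_aw_closure:
  assumes "local_approximation_class \<T>"
    and tail: "\<And>z. \<lbrakk>\<And>i. z i \<in> A; z \<longlonglongrightarrow> x\<rbrakk> \<Longrightarrow> \<exists>N. uniformly_approximated \<T> A (z ` {N..})"
  shows "pseudotangent_sets (closure A) x \<subseteq> aw_closure \<T>"
proof
  fix T assume T: "T \<in> pseudotangent_sets (closure A) x"
  obtain z r where z: "\<forall>i. z i \<in> A" "z \<longlonglongrightarrow> x" and r: "\<forall>i. r i > 0" "r \<longlonglongrightarrow> (0::real)"
    and lim: "\<forall>R. \<forall>\<eta>>0. \<forall>\<^sub>F i in sequentially.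
       near_in R \<eta> T ((*\<^sub>R) (inverse (r i)) ` recenter A (z i))"
    using pseudotangent_base_points_in_set[OF T] by blast
  have "T \<in> closed_sets0" using T unfolding pseudotangent_sets_def by blast
  obtain N where N: "uniformly_approximated \<T> A (z ` {N..})"
    using tail[OF z(1)[rule_format] z(2)] by blast
  show "T \<in> aw_closure \<T>"
  proof (rule blowup_limit_in_aw_closure[where A = A and z = z and r = r and N = N])
    show "r i > 0" for i by (rule r(1)[rule_format])
    show "\<forall>\<^sub>F i in sequentially. near_in R \<eta> T ((*\<^sub>R) (inverse (r i)) ` recenter A (z i))"
      if "\<eta> > 0" for R \<eta> by (rule lim[rule_format, OF that])
    show "local_approximation_class \<T>" "T \<in> closed_sets0" "r \<longlonglongrightarrow> 0"
      "uniformly_approximated \<T> A (z ` {N..})" by fact+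
  qed
qed

lemma pseudotangent_sets_subset_approximating_class:
  assumes "local_approximation_class \<S>" "locally_well_approximated A \<S>" "x \<in> A"
  shows "pseudotangent_sets (closure A) x \<subseteq> aw_closure \<S>"
proof (rule pseudotangent_sets_subset_aw_closure[OF assms(1)])
  fix z :: "nat \<Rightarrow> 'a" assume z: "\<And>i. z i \<in> A" "z \<longlonglongrightarrow> x"
  have "insert x (range z) \<subseteq> A" using z(1) assms(3) by auto
  then have "uniformly_approximated \<S> A (insert x (range z))"
    using assms(2) compact_sequence_with_limit[OF z(2)] by (simp add: locally_well_approximated_iff)
  then have "uniformly_approximated \<S> A (z ` {0..})" by (rule uniformly_approximated_subset) auto
  then show "\<exists>N. uniformly_approximated \<S> A (z ` {N..})" ..
qed

lemma tangent_sets_subset_pseudotangent_sets: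
  assumes "x \<in> A"
  shows "tangent_sets A x \<subseteq> pseudotangent_sets A x"
proof
  fix T assume "T \<in> tangent_sets A x"
  then obtain r where T: "T \<in> closed_sets0" and r: "\<forall>i. r i > 0" "r \<longlonglongrightarrow> (0::real)"
    "aw_converges (\<lambda>i. (\<lambda>a. (a - x) /\<^sub>R r i) ` A) T"
    unfolding tangent_sets_def by blast
  show "T \<in> pseudotangent_sets A x"
    unfolding pseudotangent_sets_def mem_Collect_eq
    by (intro conjI exI[of _ "\<lambda>_. x"] exI[of _ r] allI assms T r tendsto_const r(1)[rule_format])
qed

text \<open>
  By propagation, \<open>\<phi>\<close>-closeness to \<open>\<T>\<close> at a single small scale would put \<open>x\<close> in the regular part.
  A tangent set that is \<open>\<phi> / 4\<close>-close to \<open>\<T>\<close> at some scale \<open>\<rho>\<close> would produce such a scale, namely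
  \<open>r i * (\<rho> / 2)\<close> for large \<open>i\<close>.
\<close>

lemma tangent_sets_subset_singular_class:
  assumes \<T>: "local_approximation_class \<T>" and "detectable \<T> \<S>"
    and A: "locally_well_approximated A \<S>" and x: "x \<in> A - regular_part \<T> A"
  shows "tangent_sets (closure A) x \<subseteq> singular_class \<T>"
proof
  fix T assume T: "T \<in> tangent_sets (closure A) x"
  then obtain r where r: "\<And>i. r i > 0" "r \<longlonglongrightarrow> (0::real)"
    and conv: "aw_converges (\<lambda>i. (\<lambda>a. (a - x) /\<^sub>R r i) ` closure A) T"
    unfolding tangent_sets_def by blast
  have lim: "\<forall>\<^sub>F i in sequentially. near_in R \<eta> T ((*\<^sub>R) (inverse (r i)) ` recenter A x)"
    if "\<eta> > 0" for R \<eta>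
  proof (rule eventually_near_in_blowup[OF conv r(1) _ that])
    show "dist x x < r i * inverse (Suc i)" for i using r(1)[of i] by (simp only: dist_self) simp
  qed
  obtain \<phi> \<delta>\<^sub>0 where \<phi>: "0 < \<phi>" "\<phi> \<le> 1 / 4" and "0 < \<delta>\<^sub>0"
    and propagate: "\<And>A Y r. \<lbrakk>uniformly_approximated \<S> A Y; r > 0;
       \<And>x \<rho>. \<lbrakk>x \<in> Y; 0 < \<rho>; \<rho> \<le> r\<rbrakk> \<Longrightarrow> approx_in \<S> (recenter A x) \<rho> (\<delta>\<^sub>0 * \<rho>);
       \<And>x. x \<in> Y \<Longrightarrow> approx_in \<T> (recenter A x) r (\<phi> * r)\<rbrakk> \<Longrightarrow> uniformly_approximated \<T> A Y"
    using detectable_propagation[OF assms(2)] by blast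
  have UA: "uniformly_approximated \<S> A {x}"
    using A x by (simp add: locally_well_approximated_iff)
  obtain r\<^sub>0 where r\<^sub>0: "r\<^sub>0 > 0"
    "\<And>\<rho>. \<lbrakk>0 < \<rho>; \<rho> \<le> r\<^sub>0\<rbrakk> \<Longrightarrow> approx_in \<S> (recenter A x) \<rho> (\<delta>\<^sub>0 * \<rho>)"
    using uniformly_approximated_singletonD[OF UA \<open>0 < \<delta>\<^sub>0\<close>] by metis
  have never: "\<not> approx_in \<T> (recenter A x) \<rho> (\<phi> * \<rho>)" if "0 < \<rho>" "\<rho> \<le> r\<^sub>0" for \<rho>
  proof
    assume "approx_in \<T> (recenter A x) \<rho> (\<phi> * \<rho>)"
    then have "uniformly_approximated \<T> A {x}"
      using that r\<^sub>0(2) by (intro propagate[OF UA that(1)]) auto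
    with x show False by (simp add: regular_part_def)
  qed
  have lower: "ennreal (\<phi> / 4) \<le> approximability \<T> T 0 \<rho>" if "\<rho> > 0" for \<rho>
  proof (rule ccontr)
    assume "\<not> ennreal (\<phi> / 4) \<le> approximability \<T> T 0 \<rho>"
    then have app: "approx_in \<T> T \<rho> (\<phi> / 4 * \<rho>)"
      using approx_in_if_approximability_less[of \<T> T 0 \<rho> "\<phi> / 4"] that by simp
    have \<phi>\<rho>: "0 < \<phi> / 4 * \<rho>" "\<phi> / 4 * \<rho> \<le> \<rho> / 4" using \<phi> that by auto
    have "\<forall>\<^sub>F i in sequentially. r i < r\<^sub>0 / \<rho>"
      using r\<^sub>0(1) that by (intro order_tendstoD(2)[OF r(2)]) simp
    with lim[OF \<phi>\<rho>(1)] have "\<forall>\<^sub>F i in sequentially. r i < r\<^sub>0 / \<rho> \<and>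
        near_in \<rho> (\<phi> / 4 * \<rho>) T ((*\<^sub>R) (inverse (r i)) ` recenter A x)"
      by eventually_elim blast
    then obtain i where i: "r i < r\<^sub>0 / \<rho>"
      "near_in \<rho> (\<phi> / 4 * \<rho>) T ((*\<^sub>R) (inverse (r i)) ` recenter A x)"
      using eventually_happens'[OF sequentially_bot] by force
    have "approx_in \<T> ((*\<^sub>R) (inverse (r i)) ` recenter A x) (\<rho> / 2) (\<phi> / 4 * \<rho> + \<phi> / 4 * \<rho>)"
      by (rule approx_in_trans[OF near_in_sym[OF i(2)] app]) (use \<phi>\<rho> that in linarith)+
    from approx_in_scaleR[OF \<T> r(1)[of i] this]
    have "approx_in \<T> (recenter A x) (r i * (\<rho> / 2)) (\<phi> * (r i * (\<rho> / 2)))"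
      using r(1)[of i] by (simp add: image_image algebra_simps)
    moreover have "0 < r i * (\<rho> / 2)" using r(1) that by simp
    moreover have "r i * (\<rho> / 2) \<le> r\<^sub>0" using i(1) r\<^sub>0(1) that by (simp add: field_simps)
    ultimately show False using never by blast
  qed
  have "\<forall>\<^sub>F \<rho> in at_right 0. ennreal (\<phi> / 4) \<le> approximability \<T> T 0 \<rho>"
    unfolding eventually_at_right_field using lower by (intro exI[of _ 1]) auto
  then have "ennreal (\<phi> / 4) \<le> Liminf (at_right 0) (approximability \<T> T 0)" by (rule Liminf_bounded)
  moreover have "0 < ennreal (\<phi> / 4)" using \<phi> by simp
  ultimately have "0 < Liminf (at_right 0) (approximability \<T> T 0)" by (rule less_le_trans[rotated])
  moreover have "T \<in> closed_sets0" using T unfolding tangent_sets_def by blast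
  ultimately show "T \<in> singular_class \<T>" by (simp add: singular_class_def)
qed


section \<open>The decomposition\<close>

theorem theorem6p2:
  fixes \<T> \<S> :: "(real ^ 'n) set set" and A :: "(real ^ 'n) set"
  assumes "local_approximation_class \<T>"
    and "local_approximation_class \<S>"
    and "detectable \<T> \<S>"
    and "A \<noteq> {}"
    and "locally_well_approximated A \<S>"
  shows "\<exists>A\<^sub>T A\<^sub>P. A = A\<^sub>T \<union> A\<^sub>P \<and> A\<^sub>T \<inter> A\<^sub>P = {} \<and>
    (\<forall>x\<in>A\<^sub>T. pseudotangent_sets (closure A) x \<subseteq> aw_closure \<S> \<inter> aw_closure \<T>) \<and>
    (\<forall>x\<in>A\<^sub>P. tangent_sets (closure A) x \<subseteq> aw_closure \<S> \<inter> singular_class \<T>) \<and>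
    openin (top_of_set A) A\<^sub>T \<and>
    locally_well_approximated A\<^sub>T \<T>"
proof (rule exI[of _ "regular_part \<T> A"], rule exI[of _ "A - regular_part \<T> A"], intro conjI ballI)
  let ?A\<^sub>T = "regular_part \<T> A"
  have sub: "?A\<^sub>T \<subseteq> A" by (auto simp: regular_part_def)
  then show "A = ?A\<^sub>T \<union> (A - ?A\<^sub>T)" by blast
  show "?A\<^sub>T \<inter> (A - ?A\<^sub>T) = {}" by blast
  show "pseudotangent_sets (closure A) x \<subseteq> aw_closure \<S> \<inter> aw_closure \<T>" if "x \<in> ?A\<^sub>T" for x
  proof -
    have x: "x \<in> A" "uniformly_approximated \<T> A {x}" using that by (auto simp: regular_part_def)
    have "pseudotangent_sets (closure A) x \<subseteq> aw_closure \<T>"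
    proof (rule pseudotangent_sets_subset_aw_closure[OF assms(1)])
      fix z :: "nat \<Rightarrow> real ^ 'n" assume "\<And>i. z i \<in> A" "z \<longlonglongrightarrow> x"
      then show "\<exists>N. uniformly_approximated \<T> A (z ` {N..})"
        by (rule uniformly_approximated_tail[OF assms(3,5) x])
    qed
    with pseudotangent_sets_subset_approximating_class[OF assms(2,5) x(1)] show ?thesis by blast
  qed
  show "tangent_sets (closure A) x \<subseteq> aw_closure \<S> \<inter> singular_class \<T>" if "x \<in> A - ?A\<^sub>T" for x
  proof -
    have "x \<in> A" "x \<in> closure A" using that closure_subset by auto
    then show ?thesis
      using tangent_sets_subset_pseudotangent_sets[of x "closure A"]
        pseudotangent_sets_subset_approximating_class[OF assms(2,5), of x]
        tangent_sets_subset_singular_class[OF assms(1,3,5) that] by blast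
  qed
  show op: "openin (top_of_set A) ?A\<^sub>T" by (rule openin_regular_part[OF assms(3,5)])
  show "locally_well_approximated ?A\<^sub>T \<T>"
    by (rule locally_well_approximated_relatively_open[OF op
          uniformly_approximated_compact[OF assms(3,5)]])
qed

end
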